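(* Let $\Omega\subset\mathbb R^N$ be a bounded Lipschitz domain, $K:L^2(\Omega)\to L^2(\Omega)$ bounded and linear, $y^\delta\in L^2(\Omega)$, and $\alpha>0$. For $s\in(0,1)$ define $\mathcal J_{\alpha,s}:L^2(\Omega)\to(-\infty,+\infty]$ by $$\mathcal J_{\alpha,s}(u)=\begin{cases}\frac12\|Ku-y^\delta\|_{L^2(\Omega)}^2+\frac\alpha2\left(\|u\|_{L^2(\Omega)}^2+\mathcal E_s(u,u)\right),&u\in H_0^s(\Omega),\\ +\infty,&u\notin H_0^s(\Omega).\end{cases}$$ The family $\{\mathcal J_{\alpha,s}\}$ is equicoercive along $s\to1^-$ in $L^2(\Omega)$. More precisely, if $s_n\in(0,1)$, $s_n\to1^-$, and $\{u_n\}\subset L^2(\Omega)$ satisfies $\mathcal J_{\alpha,s_n}(u_n)\le C$ for all $n$ with some constant $C$, then $\{u_n\}$ is relatively compact in $L^2(\Omega)$.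
   Context: $H_0^s(\Omega)$ is the space of functions $u\in H^s(\mathbb R^N)$ with $u=0$ a.e. in $\mathbb R^N\setminus\Omega$; functions on $\Omega$ are extended by zero to $\mathbb R^N$. The fractional energy is $$\mathcal E_s(u,u)=\frac{C_{N,s}}{2}\iint_{\mathbb R^{2N}}\frac{|u(x)-u(y)|^2}{|x-y|^{N+2s}}\,dx\,dy,$$ where the normalization constants $C_{N,s}>0$ are chosen (Bourgain--Brezis--Mironescu normalization) so that for every $u\in H_0^1(\Omega)$, $\lim_{s\to1^-}\mathcal E_s(u,u)=\int_\Omega|\nabla u|^2\,dx$; in particular $C_{N,s}\asymp1-s$ as $s\to1^-$. *)

theory Defs
  imports "HOL-Analysis.Analysis"
begin

section \<open>The Hilbert space of square-integrable functions\<close>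

text \<open>
  The Euclidean type \<open>'a\<close> plays the role of the N-dimensional real space, with N = \<open>DIM('a)\<close>.
  Elements of \<open>'a L2\<close> are almost-everywhere classes of real square-integrable functions on the
  whole space. Borel representatives lose nothing: every Lebesgue measurable function agrees
  almost everywhere with a Borel measurable one.
\<close>

definition square_integrable :: "('a::euclidean_space \<Rightarrow> real) \<Rightarrow> bool" where
  "square_integrable f \<longleftrightarrow>
     f \<in> borel_measurable borel \<and> integrable lborel (\<lambda>x. (f x)\<^sup>2)"

definition L2_rel :: "('a::euclidean_space \<Rightarrow> real) \<Rightarrow> ('a \<Rightarrow> real) \<Rightarrow> bool" where
  "L2_rel f g \<longleftrightarrow>
     square_integrable f \<and> square_integrable g \<and> (AE x in lborel. f x = g x)"

lemma square_integrable_zero: "square_integrable (\<lambda>x. 0)"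
  by (simp add: square_integrable_def)

lemma square_integrable_mult:
  assumes "square_integrable f" "square_integrable g"
  shows "integrable lborel (\<lambda>x. f x * g x)"
proof (rule Bochner_Integration.integrable_bound)
  show "integrable lborel (\<lambda>x. (f x)\<^sup>2 + (g x)\<^sup>2)"
    using assms by (auto simp: square_integrable_def)
  show "(\<lambda>x. f x * g x) \<in> borel_measurable lborel"
    using assms by (auto simp: square_integrable_def)
  have "\<bar>a * b\<bar> \<le> a\<^sup>2 + b\<^sup>2" for a b :: real
  proof -
    have "2 * (\<bar>a\<bar> * \<bar>b\<bar>) \<le> \<bar>a\<bar>\<^sup>2 + \<bar>b\<bar>\<^sup>2"
      using sum_squares_bound[of "\<bar>a\<bar>" "\<bar>b\<bar>"] by simp
    moreover have "0 \<le> \<bar>a\<bar> * \<bar>b\<bar>" by simp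
    ultimately show ?thesis by (simp only: abs_mult power2_abs)
  qed
  then show "AE x in lborel. norm (f x * g x) \<le> norm ((f x)\<^sup>2 + (g x)\<^sup>2)"
    by simp
qed

lemma square_integrable_add:
  assumes "square_integrable f" "square_integrable g"
  shows "square_integrable (\<lambda>x. f x + g x)"
proof -
  have "integrable lborel (\<lambda>x. (f x)\<^sup>2 + (g x)\<^sup>2 + 2 * (f x * g x))"
    using assms square_integrable_mult[OF assms] by (auto simp: square_integrable_def)
  then show ?thesis
    using assms by (auto simp: square_integrable_def power2_sum algebra_simps)
qed

lemma square_integrable_scale:
  assumes "square_integrable f"
  shows "square_integrable (\<lambda>x. r * f x)"
  using assms by (auto simp: square_integrable_def power_mult_distrib)

lemma square_integrable_uminus:
  assumes "square_integrable f"
  shows "square_integrable (\<lambda>x. - f x)"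
  using assms by (auto simp: square_integrable_def)

lemma square_integrable_diff:
  assumes "square_integrable f" "square_integrable g"
  shows "square_integrable (\<lambda>x. f x - g x)"
  using square_integrable_add[OF assms(1) square_integrable_uminus[OF assms(2)]] by simp

quotient_type (overloaded) 'a L2 = "'a::euclidean_space \<Rightarrow> real" / partial: L2_rel
  morphisms L2_fun L2_class
proof (rule part_equivpI)
  show "\<exists>f :: 'a \<Rightarrow> real. L2_rel f f"
    using square_integrable_zero by (auto simp: L2_rel_def)
  show "symp (L2_rel :: ('a \<Rightarrow> real) \<Rightarrow> _)"
    by (auto simp: symp_def L2_rel_def)
  show "transp (L2_rel :: ('a \<Rightarrow> real) \<Rightarrow> _)"
    unfolding transp_def L2_rel_def by (auto elim: AE_mp)
qed

instantiation L2 :: (euclidean_space) real_inner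
begin

lift_definition zero_L2 :: "'a L2" is "\<lambda>x. 0"
  by (simp add: L2_rel_def square_integrable_zero)

lift_definition plus_L2 :: "'a L2 \<Rightarrow> 'a L2 \<Rightarrow> 'a L2" is "\<lambda>f g x. f x + g x"
  by (auto simp: L2_rel_def intro: square_integrable_add)

lift_definition uminus_L2 :: "'a L2 \<Rightarrow> 'a L2" is "\<lambda>f x. - f x"
  by (auto simp: L2_rel_def intro: square_integrable_uminus)

lift_definition minus_L2 :: "'a L2 \<Rightarrow> 'a L2 \<Rightarrow> 'a L2" is "\<lambda>f g x. f x - g x"
  by (auto simp: L2_rel_def intro: square_integrable_diff)

lift_definition scaleR_L2 :: "real \<Rightarrow> 'a L2 \<Rightarrow> 'a L2" is "\<lambda>r f x. r * f x"
  by (auto simp: L2_rel_def intro: square_integrable_scale)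

lift_definition inner_L2 :: "'a L2 \<Rightarrow> 'a L2 \<Rightarrow> real" is "\<lambda>f g. \<integral>x. f x * g x \<partial>lborel"
  by (intro integral_cong_AE) (auto simp: L2_rel_def square_integrable_def)

definition norm_L2 :: "'a L2 \<Rightarrow> real" where "norm_L2 u = sqrt (inner u u)"

definition sgn_L2 :: "'a L2 \<Rightarrow> 'a L2" where "sgn_L2 u = inverse (norm u) *\<^sub>R u"

definition dist_L2 :: "'a L2 \<Rightarrow> 'a L2 \<Rightarrow> real" where "dist_L2 u v = norm (u - v)"

definition uniformity_L2 :: "('a L2 \<times> 'a L2) filter" where
  "uniformity_L2 = (INF e\<in>{0<..}. principal {(u, v). dist u v < e})"

definition open_L2 :: "'a L2 set \<Rightarrow> bool" where
  "open_L2 U \<longleftrightarrow> (\<forall>u\<in>U. eventually (\<lambda>(u', v). u' = u \<longrightarrow> v \<in> U) uniformity)"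

instance
proof
  fix u v w :: "'a L2" and a b r :: real
  show "u + v + w = u + (v + w)"
    by transfer (auto simp: L2_rel_def add.assoc intro: square_integrable_add)
  show "u + v = v + u"
    by transfer (auto simp: L2_rel_def add.commute intro: square_integrable_add)
  show "0 + u = u"
    by transfer (auto simp: L2_rel_def)
  show "- u + u = 0"
    by transfer (auto simp: L2_rel_def square_integrable_zero)
  show "u - v = u + - v"
    by transfer (auto simp: L2_rel_def intro: square_integrable_diff)
  show "a *\<^sub>R (u + v) = a *\<^sub>R u + a *\<^sub>R v"
    by transfer
      (auto simp: L2_rel_def distrib_left intro!: square_integrable_add square_integrable_scale)
  show "(a + b) *\<^sub>R u = a *\<^sub>R u + b *\<^sub>R u"
    by transfer
      (auto simp: L2_rel_def distrib_right intro!: square_integrable_add square_integrable_scale)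
  show "a *\<^sub>R b *\<^sub>R u = (a * b) *\<^sub>R u"
    by transfer (auto simp: L2_rel_def mult.assoc intro!: square_integrable_scale)
  show "1 *\<^sub>R u = u"
    by transfer (auto simp: L2_rel_def)
  show "dist u v = norm (u - v)" by (rule dist_L2_def)
  show "sgn u = inverse (norm u) *\<^sub>R u" by (rule sgn_L2_def)
  show "uniformity = (INF e\<in>{0<..}. principal {(u :: 'a L2, v). dist u v < e})"
    by (rule uniformity_L2_def)
  show "open U \<longleftrightarrow> (\<forall>u\<in>U. eventually (\<lambda>(u', v). u' = u \<longrightarrow> v \<in> U) uniformity)"
    for U :: "'a L2 set"
    by (rule open_L2_def)
  show "inner u v = inner v u"
    by transfer (simp add: mult.commute)
  show "inner (u + v) w = inner u w + inner v w"
    by transfer (auto simp: L2_rel_def distrib_right square_integrable_mult)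
  show "inner (r *\<^sub>R u) v = r * inner u v"
    by transfer (simp add: mult.assoc)
  show "0 \<le> inner u u"
    by transfer simp
  show "inner u u = 0 \<longleftrightarrow> u = 0"
  proof (transfer, goal_cases)
    case (1 f)
    then have "square_integrable f" by (simp add: L2_rel_def)
    moreover from this have "(\<integral>x. f x * f x \<partial>lborel) = 0 \<longleftrightarrow> (AE x in lborel. f x * f x = 0)"
      by (intro integral_nonneg_eq_0_iff_AE) (auto simp: square_integrable_mult)
    ultimately show ?case by (simp add: L2_rel_def square_integrable_zero)
  qed
  show "norm u = sqrt (inner u u)" by (rule norm_L2_def)
qed

end

text \<open>
  Functions on \<open>\<Omega>\<close> are extended by zero, so the space of square-integrable functions on \<open>\<Omega>\<close> is
  the subspace of classes vanishing almost everywhere outside \<open>\<Omega>\<close>, with the inherited norm.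
  Here and below \<open>L2_fun u\<close> is some representative of the class \<open>u\<close>; nothing depends on which.
\<close>

definition L2_on :: "'a::euclidean_space set \<Rightarrow> 'a L2 set" where
  "L2_on \<Omega> = {u. AE x in lborel. x \<notin> \<Omega> \<longrightarrow> L2_fun u x = 0}"

section \<open>Bounded Lipschitz domains\<close>

text \<open>
  Near each boundary point, after choosing a unit vector \<open>e\<close> as vertical direction, the set is
  the part above the graph of a Lipschitz function on the hyperplane orthogonal to \<open>e\<close>.
\<close>

definition lipschitz_boundary :: "'a::euclidean_space set \<Rightarrow> bool" where
  "lipschitz_boundary \<Omega> \<longleftrightarrow>
     (\<forall>p \<in> frontier \<Omega>. \<exists>e r L \<gamma>. norm e = 1 \<and> 0 < r \<and> L-lipschitz_on {y. y \<bullet> e = 0} \<gamma> \<and>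
        \<Omega> \<inter> ball p r = {x \<in> ball p r. \<gamma> (x - (x \<bullet> e) *\<^sub>R e) < x \<bullet> e})"

definition bounded_lipschitz_domain :: "'a::euclidean_space set \<Rightarrow> bool" where
  "bounded_lipschitz_domain \<Omega> \<longleftrightarrow>
     open \<Omega> \<and> connected \<Omega> \<and> \<Omega> \<noteq> {} \<and> bounded \<Omega> \<and> lipschitz_boundary \<Omega>"

section \<open>Fractional Sobolev spaces and energies\<close>

definition gagliardo_kernel :: "real \<Rightarrow> 'a::euclidean_space L2 \<Rightarrow> 'a \<times> 'a \<Rightarrow> real" where
  "gagliardo_kernel s u =
     (\<lambda>(x, y). \<bar>L2_fun u x - L2_fun u y\<bar>\<^sup>2 / norm (x - y) powr (real DIM('a) + 2 * s))"

definition Hs :: "real \<Rightarrow> 'a::euclidean_space L2 set" where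
  "Hs s = {u. integrable (lborel \<Otimes>\<^sub>M lborel) (gagliardo_kernel s u)}"

definition Hs0 :: "real \<Rightarrow> 'a::euclidean_space set \<Rightarrow> 'a L2 set" where
  "Hs0 s \<Omega> = {u \<in> Hs s. AE x in lborel. x \<notin> \<Omega> \<longrightarrow> L2_fun u x = 0}"

text \<open>
  The parameter \<open>c\<close> is the family of normalization constants \<open>s \<mapsto> C\<^sub>N\<^sub>,\<^sub>s\<close>. The Bochner integral
  is the value of the double integral whenever the latter is finite, that is, for \<open>u \<in> Hs s\<close>;
  the energy is only ever used there.
\<close>

definition frac_energy :: "(real \<Rightarrow> real) \<Rightarrow> real \<Rightarrow> 'a::euclidean_space L2 \<Rightarrow> real" where
  "frac_energy c s u = c s / 2 * (\<integral>z. gagliardo_kernel s u z \<partial>(lborel \<Otimes>\<^sub>M lborel))"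

section \<open>First-order Sobolev functions and the normalization\<close>

text \<open>
  In finite dimension a function is of class \<open>C\<^sup>k\<^sup>+\<^sup>1\<close> iff it is differentiable everywhere and all its
  directional derivatives are of class \<open>C\<^sup>k\<close>.
\<close>

primrec C_k :: "nat \<Rightarrow> ('a::euclidean_space \<Rightarrow> real) \<Rightarrow> bool" where
  "C_k 0 f \<longleftrightarrow> continuous_on UNIV f"
| "C_k (Suc k) f \<longleftrightarrow> (\<forall>x. f differentiable (at x)) \<and>
     (\<forall>v. C_k k (\<lambda>x. frechet_derivative f (at x) v))"

definition test_function :: "('a::euclidean_space \<Rightarrow> real) \<Rightarrow> bool" where
  "test_function \<phi> \<longleftrightarrow> (\<forall>k. C_k k \<phi>) \<and> compact (closure {x. \<phi> x \<noteq> 0})"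

text \<open>The weak gradient on the whole space, required to be square-integrable.\<close>

definition has_weak_gradient :: "'a::euclidean_space L2 \<Rightarrow> ('a \<Rightarrow> 'a) \<Rightarrow> bool" where
  "has_weak_gradient u g \<longleftrightarrow>
     g \<in> borel_measurable borel \<and> integrable lborel (\<lambda>x. (norm (g x))\<^sup>2) \<and>
     (\<forall>\<phi>. test_function \<phi> \<longrightarrow> (\<forall>b\<in>Basis.
        (\<integral>x. L2_fun u x * frechet_derivative \<phi> (at x) b \<partial>lborel) =
        - (\<integral>x. (g x \<bullet> b) * \<phi> x \<partial>lborel)))"

definition H1 :: "'a::euclidean_space L2 set" where
  "H1 = {u. \<exists>g. has_weak_gradient u g}"

definition H10 :: "'a::euclidean_space set \<Rightarrow> 'a L2 set" where
  "H10 \<Omega> = {u \<in> H1. AE x in lborel. x \<notin> \<Omega> \<longrightarrow> L2_fun u x = 0}"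

text \<open>
  The Bourgain--Brezis--Mironescu normalization. The weak gradient is unique almost everywhere,
  so quantifying over all \<open>g\<close> is the same as speaking about the gradient of \<open>u\<close>. The asymptotics
  \<open>c s \<asymp> 1 - s\<close> are a consequence and are not part of the definition.
\<close>

definition BBM_normalized :: "'a::euclidean_space set \<Rightarrow> (real \<Rightarrow> real) \<Rightarrow> bool" where
  "BBM_normalized \<Omega> c \<longleftrightarrow>
     (\<forall>s\<in>{0<..<1}. 0 < c s) \<and>
     (\<forall>u \<in> H10 \<Omega>. \<forall>g. has_weak_gradient u g \<longrightarrow>
        ((\<lambda>s. frac_energy c s u) \<longlongrightarrow> (LINT x:\<Omega>|lborel. (norm (g x))\<^sup>2)) (at_left 1))"

section \<open>Operators, functionals and relative compactness\<close>

definition bounded_linear_on :: "'v::real_normed_vector set \<Rightarrow> ('v \<Rightarrow> 'v) \<Rightarrow> bool" where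
  "bounded_linear_on S K \<longleftrightarrow>
     K \<in> S \<rightarrow> S \<and>
     (\<forall>u\<in>S. \<forall>v\<in>S. K (u + v) = K u + K v) \<and>
     (\<forall>r. \<forall>u\<in>S. K (r *\<^sub>R u) = r *\<^sub>R K u) \<and>
     (\<exists>B. \<forall>u\<in>S. norm (K u) \<le> B * norm u)"

definition J_functional ::
  "'a::euclidean_space set \<Rightarrow> (real \<Rightarrow> real) \<Rightarrow> ('a L2 \<Rightarrow> 'a L2) \<Rightarrow> 'a L2 \<Rightarrow> real \<Rightarrow> real \<Rightarrow> 'a L2 \<Rightarrow> ereal"
  where
  "J_functional \<Omega> c K y\<delta> \<alpha> s u =
     (if u \<in> Hs0 s \<Omega>
      then ereal (1 / 2 * (norm (K u - y\<delta>))\<^sup>2 + \<alpha> / 2 * ((norm u)\<^sup>2 + frac_energy c s u))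
      else \<infinity>)"

definition relatively_compact_in :: "'v::topological_space set \<Rightarrow> 'v set \<Rightarrow> bool" where
  "relatively_compact_in X A \<longleftrightarrow>
     A \<subseteq> X \<and> compactin (top_of_set X) (top_of_set X closure_of A)"

end

theory Submission
  imports Defs
begin

text \<open>
  Let \<open>\<Phi>(t)\<close> (below \<open>osc u t\<close>) be the integral of \<open>\<bar>u x - u y\<bar>\<^sup>2\<close> over the pairs with \<open>\<bar>x - y\<bar> < t\<close>. Passing through
  midpoints gives \<open>\<Phi>(2t) \<le> 2\<^bsup>N+2\<^esup> \<Phi>(t)\<close>, so that all scales \<open>2\<^bsup>-k\<^esup> t\<close> contribute to the Gagliardo
  seminorm an amount comparable, up to the factor \<open>2\<^bsup>-k(2-2s)\<^esup>\<close>, to the contribution of scale \<open>t\<close>.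
  Summing this geometric series yields \<open>\<Phi>(t) \<le> 4 (1 - s) t\<^bsup>N+2s\<^esup> [u]\<^sub>s\<^sup>2\<close>, with the factor \<open>1 - s\<close>
  that the normalization constants compensate: testing the normalization on one bump function
  gives \<open>c s \<ge> \<kappa> (1 - s)\<close> near 1. Hence \<open>\<Phi>(t) = O(t\<^bsup>N+1\<^esup>)\<close> uniformly along the
  sequence, and a Poincare inequality on the cells of a fine grid reduces total boundedness to
  that of the finitely many cell averages.
\<close>

section \<open>Oscillation and the Gagliardo seminorm\<close>

text \<open>The obstacle is that the exponent moves: bounded energies only bound the squared
  seminorm by \<open>2 * E / c s\<close>, which may blow up like 1 / (1 - s), so a compact embedding
  for one fixed exponent does not apply directly and each estimate has to keep its power of 1 - s.
  The exact exponent N + 2 in the doubling estimate matters. Against the weight of power -(N + 2s)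
  it leaves the ratio 2^(2s-2), which tends to 1, so that the geometric series has size 1 / (1 - s).
  A doubling exponent larger by a fixed amount would keep the ratio away from 1 and lose the gain.
  For the normalization, an upper bound of order 1 / (1 - s) for the seminorm of one Lipschitz bump
  is enough, since the limit of its energies is a fixed positive number. The exponent N + 1 at the
  end is what a grid can absorb: cells have side l comparable to t and volume of order l^N, so
  division by the volume leaves one power of t to be made small.\<close>

lemma nn_integral_lborel_affine:
  fixes f :: "'a::euclidean_space \<Rightarrow> ennreal"
  assumes [measurable]: "f \<in> borel_measurable borel" and "c \<noteq> 0"
  shows "(\<integral>\<^sup>+x. f x \<partial>lborel) = ennreal (\<bar>c\<bar> ^ DIM('a)) * (\<integral>\<^sup>+x. f (t + c *\<^sub>R x) \<partial>lborel)"
  by (subst lborel_affine[OF \<open>c \<noteq> 0\<close>, of t])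
     (simp add: nn_integral_density nn_integral_distr nn_integral_cmult power_abs)

definition osc :: "('a::euclidean_space \<Rightarrow> real) \<Rightarrow> real \<Rightarrow> ennreal" where
  "osc f t = (\<integral>\<^sup>+x. \<integral>\<^sup>+y. (if dist x y < t then ennreal ((f x - f y)\<^sup>2) else 0) \<partial>lborel \<partial>lborel)"

lemma osc_measurable [measurable]:
  fixes f :: "'a::euclidean_space \<Rightarrow> real"
  assumes [measurable]: "f \<in> borel_measurable borel"
  shows "(\<lambda>(x, y). if dist x y < t then ennreal ((f x - f y)\<^sup>2) else 0)
    \<in> borel_measurable (lborel \<Otimes>\<^sub>M lborel)"
  by measurable

lemma power2_diff_le: "(a - b)\<^sup>2 \<le> 2 * (a - m)\<^sup>2 + 2 * (m - b)\<^sup>2" for a b m :: real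
  using sum_squares_bound[of "a - m" "m - b"] by (simp add: power2_eq_square algebra_simps)

text \<open>The constant is 2^N times 4. The factor 2^N is the Jacobian of passing from
  \<open>y\<close> to the midpoint with \<open>x\<close> fixed. The splitting at the midpoint costs
  a factor 2 in each of two terms, and these have equal integrals because the midpoint is symmetric
  in \<open>x\<close> and \<open>y\<close>.\<close>

lemma osc_double:
  fixes f :: "'a::euclidean_space \<Rightarrow> real"
  assumes f [measurable]: "f \<in> borel_measurable borel"
  shows "osc f (2 * t) \<le> 2 ^ (DIM('a) + 2) * osc f t"
proof -
  define g where "g x y = (if dist x y < t then ennreal ((f x - f y)\<^sup>2) else 0)" for x y
  have g [measurable]: "(\<lambda>(x, y). g x y) \<in> borel_measurable (lborel \<Otimes>\<^sub>M lborel)"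
    unfolding g_def by measurable
  have g_y [measurable]: "g x \<in> borel_measurable borel" for x
    unfolding g_def by measurable
  have gm: "(\<lambda>(x, y). g x (midpoint x y)) \<in> borel_measurable (lborel \<Otimes>\<^sub>M lborel)"
    unfolding g_def midpoint_def by measurable
  have gm': "(\<lambda>(x, y). g y (midpoint x y)) \<in> borel_measurable (lborel \<Otimes>\<^sub>M lborel)"
    unfolding g_def midpoint_def by measurable
  have sub: "(\<integral>\<^sup>+y. g x (midpoint x y) \<partial>lborel) = 2 ^ DIM('a) * (\<integral>\<^sup>+y. g x y \<partial>lborel)" for x
  proof -
    have "(\<integral>\<^sup>+y. g x (midpoint x y) \<partial>lborel) =
        ennreal (\<bar>2\<bar> ^ DIM('a)) * (\<integral>\<^sup>+y. g x (midpoint x ((- x) + 2 *\<^sub>R y)) \<partial>lborel)"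
      by (rule nn_integral_lborel_affine) (simp_all add: midpoint_def)
    also have "(\<lambda>y. g x (midpoint x ((- x) + 2 *\<^sub>R y))) = g x"
      by (simp add: midpoint_def fun_eq_iff)
    finally show ?thesis by (simp add: ennreal_power[symmetric])
  qed
  have "(if dist x y < 2 * t then ennreal ((f x - f y)\<^sup>2) else 0)
      \<le> 2 * g x (midpoint x y) + 2 * g y (midpoint x y)" for x y
  proof (cases "dist x y < 2 * t")
    case True
    moreover have "dist x (midpoint x y) = dist x y / 2" "dist y (midpoint x y) = dist x y / 2"
      by (simp_all add: dist_midpoint dist_commute)
    moreover have "ennreal ((f x - f y)\<^sup>2) \<le> ennreal (2 * (f x - f (midpoint x y))\<^sup>2 + 2 * (f y - f (midpoint x y))\<^sup>2)"
      using power2_diff_le[of "f x" "f y" "f (midpoint x y)"]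
      by (intro ennreal_leI) (simp add: power2_commute)
    ultimately show ?thesis
      by (simp add: g_def ennreal_mult)
  qed (simp)
  then have "osc f (2 * t) \<le> (\<integral>\<^sup>+x. \<integral>\<^sup>+y. 2 * g x (midpoint x y) + 2 * g y (midpoint x y) \<partial>lborel \<partial>lborel)"
    unfolding osc_def by (intro nn_integral_mono) simp
  also have "\<dots> = (\<integral>\<^sup>+x. \<integral>\<^sup>+y. 2 * g x (midpoint x y) \<partial>lborel \<partial>lborel) + (\<integral>\<^sup>+x. \<integral>\<^sup>+y. 2 * g y (midpoint x y) \<partial>lborel \<partial>lborel)"
    using gm gm' by (simp add: nn_integral_add lborel.borel_measurable_nn_integral)
  also have "(\<integral>\<^sup>+x. \<integral>\<^sup>+y. 2 * g y (midpoint x y) \<partial>lborel \<partial>lborel) = (\<integral>\<^sup>+y. \<integral>\<^sup>+x. 2 * g y (midpoint x y) \<partial>lborel \<partial>lborel)"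
    by (rule lborel_pair.Fubini') (use gm' in measurable)
  also have "\<dots> = (\<integral>\<^sup>+x. \<integral>\<^sup>+y. 2 * g x (midpoint x y) \<partial>lborel \<partial>lborel)"
    by (simp add: midpoint_sym)
  also have "(\<integral>\<^sup>+x. \<integral>\<^sup>+y. 2 * g x (midpoint x y) \<partial>lborel \<partial>lborel) = 2 * 2 ^ DIM('a) * osc f t"
    using gm by (simp add: nn_integral_cmult sub osc_def g_def[symmetric] mult.assoc lborel.borel_measurable_nn_integral)
  finally show ?thesis by (simp add: mult.assoc flip: mult_2)
qed

text \<open>Total boundedness compares two members of the sequence, so oscillation bounds must pass
  to differences.\<close>

lemma osc_diff:
  fixes f g :: "'a::euclidean_space \<Rightarrow> real"
  assumes [measurable]: "f \<in> borel_measurable borel" "g \<in> borel_measurable borel"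
  shows "osc (\<lambda>x. f x - g x) t \<le> 2 * osc f t + 2 * osc g t"
proof -
  define F where "F f x y = (if dist x y < t then ennreal ((f x - f y)\<^sup>2) else 0)" for f :: "'a \<Rightarrow> real" and x y
  have [measurable]: "(\<lambda>(x, y). F f x y) \<in> borel_measurable (lborel \<Otimes>\<^sub>M lborel)" 
    "(\<lambda>(x, y). F g x y) \<in> borel_measurable (lborel \<Otimes>\<^sub>M lborel)"
    unfolding F_def by measurable
  have "F (\<lambda>x. f x - g x) x y \<le> 2 * F f x y + 2 * F g x y" for x y
  proof -
    have "ennreal ((f x - g x - (f y - g y))\<^sup>2) \<le> ennreal (2 * (f x - f y)\<^sup>2 + 2 * (g x - g y)\<^sup>2)"
      using power2_diff_le[of "f x - f y" "g x - g y" 0]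
      by (intro ennreal_leI) (simp add: algebra_simps power2_commute[of "g y"])
    then show ?thesis by (simp add: F_def ennreal_mult)
  qed
  then have "(\<integral>\<^sup>+x. \<integral>\<^sup>+y. F (\<lambda>x. f x - g x) x y \<partial>lborel \<partial>lborel)
      \<le> (\<integral>\<^sup>+x. \<integral>\<^sup>+y. 2 * F f x y + 2 * F g x y \<partial>lborel \<partial>lborel)"
    by (intro nn_integral_mono)
  also have "\<dots> = 2 * osc f t + 2 * osc g t"
    unfolding osc_def F_def[symmetric]
    by (simp add: nn_integral_add nn_integral_cmult lborel.borel_measurable_nn_integral)
  finally show ?thesis by (simp add: osc_def F_def)
qed

section \<open>Dyadic scales against the Gagliardo seminorm\<close>

text \<open>An extended-valued iterated integral, so that it can be estimated and rearranged before
  any integrability is known. Its relation to the Bochner integral in \<open>frac_energy\<close> is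
  \<open>integral_gagliardo_kernel\<close>.\<close>

definition gagliardo :: "real \<Rightarrow> ('a::euclidean_space \<Rightarrow> real) \<Rightarrow> ennreal" where
  "gagliardo s f = (\<integral>\<^sup>+x. \<integral>\<^sup>+y.
     ennreal ((f x - f y)\<^sup>2 / norm (x - y) powr (real DIM('a) + 2 * s)) \<partial>lborel \<partial>lborel)"

lemma gagliardo_measurable [measurable]:
  fixes f :: "'a::euclidean_space \<Rightarrow> real"
  assumes [measurable]: "f \<in> borel_measurable borel"
  shows "(\<lambda>(x, y). (f x - f y)\<^sup>2 / norm (x - y) powr a) \<in> borel_measurable (lborel \<Otimes>\<^sub>M lborel)"
  by measurable

text \<open>Since \<open>a\<close> is at least 1, each term is at least twice its predecessor, so
  the last term dominates the sum of all.\<close>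

lemma sum_dyadic_powr_atMost:
  fixes t a :: real
  assumes "0 < t" "1 \<le> a"
  shows "(\<Sum>k\<le>m. (t / 2 ^ k) powr (- a)) \<le> 2 * (t / 2 ^ m) powr (- a)"
proof (induction m)
  case (Suc m)
  have "(t / 2 ^ Suc m) powr (- a) = (t / 2 ^ m) powr (- a) * 2 powr a"
    using assms by (simp add: powr_divide powr_minus powr_mult field_simps)
  moreover have "2 \<le> (2::real) powr a"
    using powr_mono[of 1 a 2] assms by simp
  ultimately have "2 * (t / 2 ^ m) powr (- a) \<le> (t / 2 ^ Suc m) powr (- a)"
    by (simp add: mult.commute mult_right_mono)
  with Suc show ?case by simp
qed simp

text \<open>Only scales above \<open>d\<close> count. The smallest of them carries the largest term,
  which is still below \<open>d powr (- a)\<close>.\<close>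

lemma sum_dyadic_powr_le:
  fixes t a d :: real
  assumes "0 < d" "0 < t" "1 \<le> a"
  shows "(\<Sum>k<n. if d < t / 2 ^ k then (t / 2 ^ k) powr (- a) else 0) \<le> 2 * d powr (- a)"
proof (induction n)
  case (Suc n)
  show ?case
  proof (cases "d < t / 2 ^ n")
    case True
    have "(\<Sum>k<Suc n. if d < t / 2 ^ k then (t / 2 ^ k) powr (- a) else 0)
        \<le> (\<Sum>k\<le>n. (t / 2 ^ k) powr (- a))"
      unfolding lessThan_Suc_atMost by (intro sum_mono) simp
    also have "\<dots> \<le> 2 * (t / 2 ^ n) powr (- a)"
      using assms by (intro sum_dyadic_powr_atMost)
    also have "\<dots> \<le> 2 * d powr (- a)"
      using True assms by (intro mult_left_mono powr_mono2') auto
    finally show ?thesis .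
  qed (use Suc in simp)
qed simp

text \<open>A pair of points enters only at scales exceeding its distance, and the weights of those
  scales add up to at most twice the singular kernel at that distance. The estimate is thus
  pointwise under the double integral.\<close>

lemma sum_osc_le_gagliardo:
  fixes f :: "'a::euclidean_space \<Rightarrow> real"
  assumes f [measurable]: "f \<in> borel_measurable borel" and "0 < s" "0 < t"
  defines "a \<equiv> real DIM('a) + 2 * s"
  shows "(\<Sum>k<n. ennreal ((t / 2 ^ k) powr (- a)) * osc f (t / 2 ^ k)) \<le> 2 * gagliardo s f"
proof -
  define g where "g k x y = (if dist x y < t / 2 ^ k then ennreal ((f x - f y)\<^sup>2) else 0)" for k x y
  have [measurable]: "(\<lambda>(x, y). g k x y) \<in> borel_measurable (lborel \<Otimes>\<^sub>M lborel)" for k :: nat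
    unfolding g_def by measurable
  have [measurable]: "(\<lambda>(x, y). (f x - f y)\<^sup>2 / norm (x - y) powr a) \<in> borel_measurable (lborel \<Otimes>\<^sub>M lborel)"
    by measurable
  have "1 \<le> a"
    using DIM_ge_Suc0[where 'a='a] \<open>0 < s\<close> unfolding a_def by linarith
  have pt: "(\<Sum>k<n. ennreal ((t / 2 ^ k) powr (- a)) * g k x y)
      \<le> 2 * ennreal ((f x - f y)\<^sup>2 / norm (x - y) powr a)" for x y
  proof (cases "x = y")
    case True
    then show ?thesis by (simp add: g_def)
  next
    case False
    have "(\<Sum>k<n. ennreal ((t / 2 ^ k) powr (- a)) * g k x y)
        = (\<Sum>k<n. ennreal ((f x - f y)\<^sup>2 * (if dist x y < t / 2 ^ k then (t / 2 ^ k) powr (- a) else 0)))"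
      by (intro sum.cong) (simp_all add: g_def ennreal_mult' mult.commute)
    also have "\<dots> = ennreal ((f x - f y)\<^sup>2 * (\<Sum>k<n. if dist x y < t / 2 ^ k then (t / 2 ^ k) powr (- a) else 0))"
      by (subst sum_ennreal) (simp_all add: sum_distrib_left)
    also have "\<dots> \<le> ennreal ((f x - f y)\<^sup>2 * (2 * dist x y powr (- a)))"
      using False \<open>0 < t\<close> \<open>1 \<le> a\<close>
      by (intro ennreal_leI mult_left_mono sum_dyadic_powr_le) simp_all
    also have "\<dots> = 2 * ennreal ((f x - f y)\<^sup>2 / norm (x - y) powr a)"
      by (simp add: dist_norm powr_minus divide_inverse mult.left_commute ennreal_mult)
    finally show ?thesis .
  qed
  have "(\<Sum>k<n. ennreal ((t / 2 ^ k) powr (- a)) * osc f (t / 2 ^ k))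
      = (\<integral>\<^sup>+x. \<integral>\<^sup>+y. (\<Sum>k<n. ennreal ((t / 2 ^ k) powr (- a)) * g k x y) \<partial>lborel \<partial>lborel)"
    unfolding osc_def g_def[symmetric]
    by (simp add: nn_integral_sum nn_integral_cmult lborel.borel_measurable_nn_integral)
  also have "\<dots> \<le> (\<integral>\<^sup>+x. \<integral>\<^sup>+y. 2 * ennreal ((f x - f y)\<^sup>2 / norm (x - y) powr a) \<partial>lborel \<partial>lborel)"
    by (intro nn_integral_mono pt)
  also have "\<dots> = 2 * gagliardo s f"
    unfolding gagliardo_def a_def[symmetric]
    by (simp add: nn_integral_cmult lborel.borel_measurable_nn_integral)
  finally show ?thesis .
qed

lemma osc_dyadic:
  fixes f :: "'a::euclidean_space \<Rightarrow> real"
  assumes [measurable]: "f \<in> borel_measurable borel"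
  shows "osc f t \<le> 2 ^ ((DIM('a) + 2) * k) * osc f (t / 2 ^ k)"
proof (induction k)
  case (Suc k)
  have "osc f (t / 2 ^ k) \<le> 2 ^ (DIM('a) + 2) * osc f (t / 2 ^ Suc k)"
    using osc_double[of f "t / 2 ^ Suc k"] by simp
  with Suc have "osc f t \<le> 2 ^ ((DIM('a) + 2) * k) * (2 ^ (DIM('a) + 2) * osc f (t / 2 ^ Suc k))"
    by (meson mult_left_mono order_trans zero_le)
  then show ?case by (simp add: power_add mult_ac)
qed simp

text \<open>The constant 4 has two sources: a factor 2 from \<open>sum_osc_le_gagliardo\<close> and
  a factor 2 from \<open>1 - \<rho> \<le> 2 * (1 - s)\<close>.\<close>

lemma osc_le_gagliardo:
  fixes f :: "'a::euclidean_space \<Rightarrow> real"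
  assumes f [measurable]: "f \<in> borel_measurable borel" and s: "0 < s" "s < 1" and t: "0 < t"
    and E: "gagliardo s f \<le> ennreal E" "0 \<le> E"
  shows "osc f t \<le> ennreal (4 * (1 - s) * E * t powr (real DIM('a) + 2 * s))"
proof -
  define a where "a = real DIM('a) + 2 * s"
  define \<rho> where "\<rho> = (2::real) powr (2 * s - 2)"
  have \<rho>: "0 < \<rho>" "\<rho> < 1"
    using s by (auto simp: \<rho>_def powr_less_one)
  have sum: "(\<Sum>k<n. ennreal ((t / 2 ^ k) powr (- a)) * osc f (t / 2 ^ k)) \<le> ennreal (2 * E)" for n
    using order_trans[OF sum_osc_le_gagliardo[OF f s(1) t, of n] mult_left_mono[OF E(1), of 2]] E(2)
    unfolding a_def by (simp add: ennreal_mult)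
  \<comment> \<open>The term of index 0 alone forces finiteness. The rest can then run in the reals,
    where multiplication by \<open>1 - \<rho>\<close> sums the geometric series.\<close>
  have "osc f t < \<infinity>"
    using sum[of 1] t by (auto simp: ennreal_mult_eq_top_iff top_unique less_top[symmetric])
  then obtain r where r: "osc f t = ennreal r" "0 \<le> r"
    by (cases "osc f t") auto
  \<comment> \<open>The weight gains 2^(k(N+2s)) while iterated doubling loses 2^(k(N+2)). The
    quotient is the power \<open>\<rho> ^ k\<close>.\<close>
  have coeff: "(t / 2 ^ k) powr (- a) / 2 ^ ((DIM('a) + 2) * k) = t powr (- a) * \<rho> ^ k" for k
  proof -
    have "(t / 2 ^ k) powr (- a) / 2 ^ ((DIM('a) + 2) * k)
        = (t / 2 powr real k) powr (- a) / 2 powr real ((DIM('a) + 2) * k)"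
      by (simp only: powr_realpow zero_less_numeral)
    also have "\<dots> = t powr (- a) * (2 powr (real k * a) / 2 powr real ((DIM('a) + 2) * k))"
      using t by (simp add: powr_divide powr_powr powr_minus field_simps)
    also have "\<dots> = t powr (- a) * 2 powr (real k * a - real ((DIM('a) + 2) * k))"
      by (simp add: powr_diff)
    also have "real k * a - real ((DIM('a) + 2) * k) = (2 * s - 2) * real k"
      by (simp add: a_def algebra_simps)
    also have "2 powr ((2 * s - 2) * real k) = \<rho> ^ k"
      by (simp add: \<rho>_def powr_power mult.commute)
    finally show ?thesis .
  qed
  have summand: "ennreal (t powr (- a) * \<rho> ^ k * r) \<le> ennreal ((t / 2 ^ k) powr (- a)) * osc f (t / 2 ^ k)" for k
  proof -
    have "ennreal (t powr (- a) * \<rho> ^ k * r)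
        = ennreal ((t / 2 ^ k) powr (- a) / 2 ^ ((DIM('a) + 2) * k)) * osc f t"
      unfolding coeff r using r \<rho> by (simp add: ennreal_mult)
    also have "\<dots> \<le> ennreal ((t / 2 ^ k) powr (- a) / 2 ^ ((DIM('a) + 2) * k))
        * (ennreal (2 ^ ((DIM('a) + 2) * k)) * osc f (t / 2 ^ k))"
      using osc_dyadic[OF f, of t k] by (intro mult_left_mono) (simp_all add: ennreal_power[symmetric])
    also have "\<dots> = ennreal ((t / 2 ^ k) powr (- a)) * osc f (t / 2 ^ k)"
      by (simp add: mult.assoc[symmetric] ennreal_mult[symmetric])
    finally show ?thesis .
  qed
  have "t powr (- a) * r * (1 - \<rho> ^ n) \<le> 2 * E * (1 - \<rho>)" for n
  proof -
    have "ennreal (\<Sum>k<n. t powr (- a) * \<rho> ^ k * r) \<le> ennreal (2 * E)"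
      using order_trans[OF sum_mono[OF summand] sum] r \<rho> by (simp add: sum_ennreal)
    then have "t powr (- a) * r * (\<Sum>k<n. \<rho> ^ k) \<le> 2 * E"
      using E by (simp add: sum_distrib_left mult_ac)
    then have "t powr (- a) * r * (\<Sum>k<n. \<rho> ^ k) * (1 - \<rho>) \<le> 2 * E * (1 - \<rho>)"
      using \<rho> by (intro mult_right_mono) auto
    moreover have "(\<Sum>k<n. \<rho> ^ k) * (1 - \<rho>) = 1 - \<rho> ^ n"
      using one_diff_power_eq[of \<rho> n] by (simp add: mult.commute)
    ultimately show ?thesis
      by (simp add: mult.assoc)
  qed
  moreover have "(\<lambda>n. t powr (- a) * r * (1 - \<rho> ^ n)) \<longlonglongrightarrow> t powr (- a) * r * (1 - 0)"
    using \<rho> by (intro tendsto_intros LIMSEQ_power_zero) auto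
  ultimately have "t powr (- a) * r \<le> 2 * E * (1 - \<rho>)"
    using LIMSEQ_le_const2[of _ _ "2 * E * (1 - \<rho>)"] by fastforce
  \<comment> \<open>Convexity of the exponential bounds \<open>\<rho>\<close> below by its tangent
    at s = 1, and \<open>ln 2 < 1\<close>.\<close>
  also have "1 - \<rho> \<le> 2 * (1 - s)"
  proof -
    have "(2 - 2 * s) * ln 2 \<le> (2 - 2 * s) * 1"
      using ln_2_less_1 s by (intro mult_left_mono) auto
    moreover have "1 + (2 * s - 2) * ln 2 \<le> \<rho>"
      unfolding \<rho>_def powr_def using exp_ge_add_one_self[of "(2 * s - 2) * ln 2"] by simp
    ultimately show ?thesis by (simp add: algebra_simps)
  qed
  then have "2 * E * (1 - \<rho>) \<le> 2 * E * (2 * (1 - s))"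
    using E by (intro mult_left_mono) auto
  finally have "r \<le> 4 * (1 - s) * E * t powr a"
    using t by (simp add: powr_minus divide_inverse[symmetric] pos_divide_le_eq mult_ac)
  then show ?thesis
    using r by (simp add: a_def ennreal_leI)
qed

section \<open>Completeness of the space of square-integrable classes\<close>

lemma square_integrable_L2_fun: "square_integrable (L2_fun u)"
  using Quotient3_rel_rep[OF Quotient3_L2, of u u] by (simp add: L2_rel_def)

lemma L2_fun_measurable [measurable]: "L2_fun u \<in> borel_measurable borel"
  using square_integrable_L2_fun by (auto simp: square_integrable_def)

lemma L2_class_inverse_AE:
  assumes "square_integrable f"
  shows "AE x in lborel. L2_fun (L2_class f) x = f x"
  using Quotient3_rep_abs[OF Quotient3_L2, of f] assms by (simp add: L2_rel_def)

lemma L2_fun_minus: "AE x in lborel. L2_fun (u - v) x = L2_fun u x - L2_fun v x"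
proof -
  have "u - v = L2_class (\<lambda>x. L2_fun u x - L2_fun v x)"
    by (simp add: minus_L2_def)
  then show ?thesis
    using L2_class_inverse_AE[OF square_integrable_diff[OF square_integrable_L2_fun square_integrable_L2_fun]]
    by simp
qed

lemma norm_L2_sq: "(norm u)\<^sup>2 = (\<integral>x. (L2_fun u x)\<^sup>2 \<partial>lborel)"
  by (simp add: norm_L2_def inner_L2.rep_eq power2_eq_square integral_nonneg_AE)

lemma ennreal_norm_L2_sq: "ennreal ((norm u)\<^sup>2) = (\<integral>\<^sup>+x. ennreal ((L2_fun u x)\<^sup>2) \<partial>lborel)"
  using square_integrable_L2_fun[of u] unfolding norm_L2_sq square_integrable_def
  by (intro nn_integral_eq_integral[symmetric]) auto

lemma ennreal_norm_L2_minus_sq: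
  "ennreal ((norm (u - v))\<^sup>2) = (\<integral>\<^sup>+x. ennreal ((L2_fun u x - L2_fun v x)\<^sup>2) \<partial>lborel)"
  unfolding ennreal_norm_L2_sq using L2_fun_minus[of u v]
  by (intro nn_integral_cong_AE) (auto elim!: eventually_mono)

text \<open>Each \<open>v n\<close> vanishes outside \<Omega>, so the mass of \<open>u\<close> there
  is at most \<open>(norm (u - v n))\<^sup>2\<close>. Closedness makes the closure inside the
  subspace agree with the closure in the whole space.\<close>

lemma closed_L2_on:
  assumes [measurable]: "\<Omega> \<in> sets borel"
  shows "closed (L2_on \<Omega> :: 'a::euclidean_space L2 set)"
  unfolding closed_sequential_limits
proof (intro allI impI, elim conjE)
  fix v :: "nat \<Rightarrow> 'a L2" and u
  assume v: "\<forall>n. v n \<in> L2_on \<Omega>" and lim: "v \<longlonglongrightarrow> u"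
  have le: "(\<integral>\<^sup>+x. ennreal ((L2_fun u x)\<^sup>2) * indicator (- \<Omega>) x \<partial>lborel) \<le> ennreal ((norm (u - v n))\<^sup>2)" for n
  proof -
    have "AE x in lborel. ennreal ((L2_fun u x)\<^sup>2) * indicator (- \<Omega>) x \<le> ennreal ((L2_fun (u - v n) x)\<^sup>2)"
      using v[rule_format, of n, unfolded L2_on_def mem_Collect_eq] L2_fun_minus[of u "v n"]
      by eventually_elim (auto split: split_indicator)
    then show ?thesis
      unfolding ennreal_norm_L2_sq by (rule nn_integral_mono_AE)
  qed
  have "(\<lambda>n. ennreal ((norm (u - v n))\<^sup>2)) \<longlonglongrightarrow> ennreal ((norm (u - u))\<^sup>2)"
    by (intro tendsto_intros lim)
  then have "(\<integral>\<^sup>+x. ennreal ((L2_fun u x)\<^sup>2) * indicator (- \<Omega>) x \<partial>lborel) \<le> ennreal ((norm (u - u))\<^sup>2)"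
    by (rule LIMSEQ_le_const) (use le in auto)
  then have "(\<integral>\<^sup>+x. ennreal ((L2_fun u x)\<^sup>2) * indicator (- \<Omega>) x \<partial>lborel) = 0"
    by simp
  then have "AE x in lborel. ennreal ((L2_fun u x)\<^sup>2) * indicator (- \<Omega>) x = 0"
    by (subst (asm) nn_integral_0_iff_AE) auto
  then show "u \<in> L2_on \<Omega>"
    unfolding L2_on_def by (auto elim!: eventually_mono)
qed

text \<open>Riesz--Fischer. Summability of \<open>2\<^sup>k \<bar>f\<^sub>k\<^sub>+\<^sub>1 - f\<^sub>k\<bar>\<^sup>2\<close> almost everywhere replaces
  Minkowski's inequality for infinite sums.\<close>

instance L2 :: (euclidean_space) complete_space
proof
  fix X :: "nat \<Rightarrow> 'a L2"
  assume X: "Cauchy X"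
  have "\<exists>r. strict_mono r \<and> (\<forall>k. norm (X (r (Suc k)) - X (r k)) < (1/2) ^ k)"
  proof -
    have "\<exists>M. \<forall>m\<ge>M. \<forall>n\<ge>M. norm (X m - X n) < (1/2) ^ k" for k
      using X[unfolded Cauchy_def, rule_format, of "(1/2)^k"] by (simp add: dist_norm)
    then obtain M where M: "\<And>k m n. m \<ge> M k \<Longrightarrow> n \<ge> M k \<Longrightarrow> norm (X m - X n) < (1/2) ^ k"
      by metis
    define r where "r = rec_nat (M 0) (\<lambda>k r. max (Suc r) (M (Suc k)))"
    have "r k \<ge> M k" for k by (cases k) (auto simp: r_def)
    moreover have "strict_mono r" by (rule strict_monoI_Suc) (auto simp: r_def)
    ultimately show ?thesis
      by (intro exI[of _ r] conjI allI M) (auto intro: order_trans[OF _ less_imp_le[OF strict_monoD]])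
  qed
  then obtain r where r: "strict_mono r" and step: "\<And>k. norm (X (r (Suc k)) - X (r k)) < (1/2) ^ k"
    by blast
  define F where "F k = L2_fun (X (r k))" for k
  have [measurable]: "F k \<in> borel_measurable borel" for k
    by (simp add: F_def)
  have int_diff: "(\<integral>\<^sup>+x. ennreal ((F m x - F k x)\<^sup>2) \<partial>lborel) = ennreal ((norm (X (r m) - X (r k)))\<^sup>2)" for m k
    unfolding ennreal_norm_L2_minus_sq F_def ..
  \<comment> \<open>The squared norms of the increments are at most \<open>(1/4) ^ k\<close>, so the
    weight \<open>2 ^ k\<close> still leaves a summable majorant.\<close>
  have "(\<integral>\<^sup>+x. (\<Sum>k. ennreal (2 ^ k * (F (Suc k) x - F k x)\<^sup>2)) \<partial>lborel) =
      (\<Sum>k. \<integral>\<^sup>+x. ennreal (2 ^ k * (F (Suc k) x - F k x)\<^sup>2) \<partial>lborel)"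
    by (intro nn_integral_suminf) measurable
  also have "\<dots> \<le> (\<Sum>k. ennreal ((1/2) ^ k))"
  proof (intro suminf_le allI)
    fix k
    have "(\<integral>\<^sup>+x. ennreal (2 ^ k * (F (Suc k) x - F k x)\<^sup>2) \<partial>lborel)
        = ennreal (2 ^ k) * ennreal ((norm (X (r (Suc k)) - X (r k)))\<^sup>2)"
      unfolding int_diff[symmetric] by (simp add: ennreal_mult nn_integral_cmult)
    also have "\<dots> = ennreal (2 ^ k * (norm (X (r (Suc k)) - X (r k)))\<^sup>2)"
      by (simp add: ennreal_mult)
    also have "\<dots> \<le> ennreal (2 ^ k * ((1/2) ^ k)\<^sup>2)"
      using step[of k] by (intro ennreal_leI mult_left_mono power_mono) auto
    also have "2 ^ k * ((1/2) ^ k)\<^sup>2 = (1/2::real) ^ k"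
      by (simp add: power2_eq_square power_one_over)
    finally show "(\<integral>\<^sup>+x. ennreal (2 ^ k * (F (Suc k) x - F k x)\<^sup>2) \<partial>lborel) \<le> ennreal ((1/2) ^ k)" .
  qed auto
  also have "\<dots> < \<infinity>"
    by (subst suminf_ennreal2) (auto intro: summable_geometric)
  finally have "AE x in lborel. (\<Sum>k. ennreal (2 ^ k * (F (Suc k) x - F k x)\<^sup>2)) \<noteq> \<infinity>"
    by (intro nn_integral_PInf_AE) (auto simp: less_top)
  then have AE_conv: "AE x in lborel. convergent (\<lambda>k. F k x)"
  proof eventually_elim
    case (elim x)
    define S where "S = enn2real (\<Sum>k. ennreal (2 ^ k * (F (Suc k) x - F k x)\<^sup>2))"
    have le: "2 ^ k * (F (Suc k) x - F k x)\<^sup>2 \<le> S" for k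
    proof -
      have "ennreal (2 ^ k * (F (Suc k) x - F k x)\<^sup>2) \<le> ennreal S"
        using elim sum_le_suminf[of "\<lambda>k. ennreal (2 ^ k * (F (Suc k) x - F k x)\<^sup>2)" "{k}"]
        by (simp add: S_def less_top)
      then show ?thesis by (simp add: S_def)
    qed
    have "0 \<le> S" by (simp add: S_def)
    have eq: "(sqrt S * (1 / sqrt 2) ^ k)\<^sup>2 = S / 2 ^ k" for k
    proof -
      have "(sqrt 2 ^ k)\<^sup>2 = ((sqrt 2)\<^sup>2) ^ k"
        by (simp only: mult.commute flip: power_mult)
      then show ?thesis
        using \<open>0 \<le> S\<close> by (simp add: power_mult_distrib power_divide)
    qed
    \<comment> \<open>Here the weight pays off: a finite weighted sum makes the increments
      themselves decay geometrically, hence the telescoping series converges absolutely at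
      \<open>x\<close>.\<close>
    have "\<bar>F (Suc k) x - F k x\<bar>\<^sup>2 \<le> (sqrt S * (1 / sqrt 2) ^ k)\<^sup>2" for k
      unfolding eq using le[of k] by (simp add: field_simps)
    then have "\<bar>F (Suc k) x - F k x\<bar> \<le> sqrt S * (1 / sqrt 2) ^ k" for k
      by (rule power2_le_imp_le) (simp add: \<open>0 \<le> S\<close>)
    then have "norm (F (Suc k) x - F k x) \<le> sqrt S * (1 / sqrt 2) ^ k" for k
      by simp
    moreover have "summable (\<lambda>k. sqrt S * (1 / sqrt 2) ^ k)"
      by (intro summable_mult summable_geometric) auto
    ultimately have "summable (\<lambda>k. F (Suc k) x - F k x)"
      by (rule summable_comparison_test'[rotated])
    then have "convergent (\<lambda>k. F k x - F 0 x)"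
      unfolding summable_iff_convergent using sum_lessThan_telescope[of "\<lambda>k. F k x"] by simp
    then show ?case
      by (simp add: convergent_diff_const_right_iff)
  qed
  define f where "f x = lim (\<lambda>k. F k x)" for x
  have [measurable]: "f \<in> borel_measurable borel"
    unfolding f_def by measurable
  have AE_lim: "AE x in lborel. (\<lambda>k. F k x) \<longlonglongrightarrow> f x"
    using AE_conv unfolding f_def by (simp add: convergent_LIMSEQ_iff)
  \<comment> \<open>Fatou's lemma in \<open>m\<close> measures the distance to the pointwise limit
    before that limit is known to be square-integrable.\<close>
  have fatou: "(\<integral>\<^sup>+x. ennreal ((f x - F k x)\<^sup>2) \<partial>lborel)
      \<le> liminf (\<lambda>m. ennreal ((norm (X (r m) - X (r k)))\<^sup>2))" for k
  proof -
    have "AE x in lborel. ennreal ((f x - F k x)\<^sup>2) = liminf (\<lambda>m. ennreal ((F m x - F k x)\<^sup>2))"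
      using AE_lim
    proof eventually_elim
      case (elim x)
      then have "(\<lambda>m. ennreal ((F m x - F k x)\<^sup>2)) \<longlonglongrightarrow> ennreal ((f x - F k x)\<^sup>2)"
        by (intro tendsto_intros)
      then show ?case
        using lim_imp_Liminf[OF sequentially_bot] by metis
    qed
    then have "(\<integral>\<^sup>+x. ennreal ((f x - F k x)\<^sup>2) \<partial>lborel)
        = (\<integral>\<^sup>+x. liminf (\<lambda>m. ennreal ((F m x - F k x)\<^sup>2)) \<partial>lborel)"
      by (rule nn_integral_cong_AE)
    also have "\<dots> \<le> liminf (\<lambda>m. \<integral>\<^sup>+x. ennreal ((F m x - F k x)\<^sup>2) \<partial>lborel)"
      by (intro nn_integral_liminf) measurable
    finally show ?thesis unfolding int_diff .
  qed
  have small: "\<exists>N. \<forall>k\<ge>N. (\<integral>\<^sup>+x. ennreal ((f x - F k x)\<^sup>2) \<partial>lborel) \<le> ennreal (e\<^sup>2)" if "0 < e" for e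
  proof -
    obtain M where M: "\<And>m n. m \<ge> M \<Longrightarrow> n \<ge> M \<Longrightarrow> norm (X m - X n) < e"
      using X \<open>0 < e\<close> unfolding Cauchy_def dist_norm by blast
    have "liminf (\<lambda>m. ennreal ((norm (X (r m) - X (r k)))\<^sup>2)) \<le> ennreal (e\<^sup>2)" if "k \<ge> M" for k
    proof (rule order_trans[OF Liminf_le_Limsup Limsup_bounded])
      show "\<forall>\<^sub>F m in sequentially. ennreal ((norm (X (r m) - X (r k)))\<^sup>2) \<le> ennreal (e\<^sup>2)"
        using eventually_ge_at_top[of M]
      proof eventually_elim
        case (elim m)
        then have "norm (X (r m) - X (r k)) < e"
          using seq_suble[OF r] that by (intro M) (auto intro: order_trans)
        then show ?case by (intro ennreal_leI power_mono) auto
      qed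
    qed simp
    then show ?thesis using fatou by (meson order_trans)
  qed
  obtain N where N: "(\<integral>\<^sup>+x. ennreal ((f x - F N x)\<^sup>2) \<partial>lborel) \<le> ennreal (1\<^sup>2)"
    using small[of 1] by auto
  \<comment> \<open>One index at distance at most 1 suffices: \<open>f\<close> is the sum of this
    difference and the square-integrable \<open>F N\<close>.\<close>
  have "square_integrable (\<lambda>x. f x - F N x)"
    using N unfolding square_integrable_def
    by (auto intro!: integrableI_nonneg simp: top_unique less_top[symmetric])
  then have f: "square_integrable f"
    using square_integrable_add[OF _ square_integrable_L2_fun[of "X (r N)"], of "\<lambda>x. f x - F N x"]
    by (simp add: F_def)
  define u where "u = L2_class f"
  have norm_le: "(\<integral>\<^sup>+x. ennreal ((f x - F k x)\<^sup>2) \<partial>lborel) = ennreal ((norm (u - X (r k)))\<^sup>2)" for k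
    unfolding ennreal_norm_L2_sq
    using L2_fun_minus[of u "X (r k)"] L2_class_inverse_AE[OF f]
    by (intro nn_integral_cong_AE, elim AE_mp) (auto simp: F_def u_def intro!: AE_I2)
  have "(X \<circ> r) \<longlonglongrightarrow> u"
  proof (rule metric_LIMSEQ_I)
    fix e :: real assume "0 < e"
    then obtain N where N: "\<And>k. k \<ge> N \<Longrightarrow> (norm (u - X (r k)))\<^sup>2 \<le> (e / 2)\<^sup>2"
      using small[of "e / 2"] unfolding norm_le by (auto simp: ennreal_le_iff)
    have "dist ((X \<circ> r) k) u < e" if "k \<ge> N" for k
      using power2_le_imp_le[OF N[OF that]] \<open>0 < e\<close> by (simp add: dist_norm norm_minus_commute)
    then show "\<exists>N. \<forall>k\<ge>N. dist ((X \<circ> r) k) u < e" by blast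
  qed
  then show "convergent X"
    using Cauchy_converges_subseq[OF X r] by (auto simp: convergent_def)
qed

section \<open>Grids and total boundedness\<close>

text \<open>The integer multi-index of the half-open cube of side \<open>l\<close> containing
  \<open>x\<close>, stored as a vector of the same space, so that cells are preimages of points
  under a Borel map. The index is not scaled: the lower corner of the cube is
  \<open>l *\<^sub>R grid l x\<close>.\<close>

definition grid :: "real \<Rightarrow> 'a::euclidean_space \<Rightarrow> 'a" where
  "grid l x = (\<Sum>b\<in>Basis. of_int \<lfloor>x \<bullet> b / l\<rfloor> *\<^sub>R b)"

lemma grid_inner: "b \<in> Basis \<Longrightarrow> grid l x \<bullet> b = of_int \<lfloor>x \<bullet> b / l\<rfloor>"
  by (simp add: grid_def)

lemma grid_measurable [measurable]: "grid l \<in> borel_measurable borel"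
  unfolding grid_def by measurable

text \<open>The norm is at most the sum of the absolute coordinates. The extra 1 in the factor turns
  this into a strict inequality, the form in which \<open>osc\<close> restricts pairs.\<close>

lemma dist_less_if_grid_eq:
  fixes x y :: "'a::euclidean_space" and l :: real
  assumes "grid l x = grid l y" "0 < l"
  shows "dist x y < (DIM('a) + 1) * l"
proof -
  have "\<bar>(x - y) \<bullet> b\<bar> \<le> l" if b: "b \<in> Basis" for b
  proof -
    have "\<lfloor>x \<bullet> b / l\<rfloor> = \<lfloor>y \<bullet> b / l\<rfloor>"
      using assms(1) grid_inner[OF b, of l] by (metis of_int_eq_iff)
    then have "\<bar>x \<bullet> b / l - y \<bullet> b / l\<bar> < 1"
      by linarith
    then show ?thesis
      using \<open>0 < l\<close> by (auto simp: inner_diff_left abs_less_iff abs_le_iff field_simps)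
  qed
  then have "(\<Sum>b\<in>Basis. \<bar>(x - y) \<bullet> b\<bar>) \<le> DIM('a) * l"
    using sum_bounded_above[of Basis "\<lambda>b. \<bar>(x - y) \<bullet> b\<bar>" l] by simp
  then have "dist x y \<le> DIM('a) * l"
    using norm_le_l1[of "x - y"] by (simp add: dist_norm)
  then show ?thesis
    using \<open>0 < l\<close> by (simp add: algebra_simps)
qed

lemma finite_grid_image:
  fixes \<Omega> :: "'a::euclidean_space set" and l :: real
  assumes "bounded \<Omega>" "0 < l"
  shows "finite (grid l ` \<Omega>)"
proof -
  obtain B where B: "\<And>x. x \<in> \<Omega> \<Longrightarrow> norm x \<le> B"
    using assms by (auto simp: bounded_iff)
  have "grid l ` \<Omega> \<subseteq> (\<lambda>j. \<Sum>b\<in>Basis. of_int (j b) *\<^sub>R b) ` (Basis \<rightarrow>\<^sub>E {\<lfloor>- B / l\<rfloor>..\<lfloor>B / l\<rfloor>})"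
  proof (rule image_subsetI)
    fix x assume "x \<in> \<Omega>"
    have "\<bar>x \<bullet> b\<bar> \<le> B" if "b \<in> Basis" for b
      using Basis_le_norm[OF that, of x] B[OF \<open>x \<in> \<Omega>\<close>] by simp
    then have "- B / l \<le> x \<bullet> b / l" "x \<bullet> b / l \<le> B / l" if "b \<in> Basis" for b
      using that \<open>0 < l\<close> divide_right_mono[of "- B" "x \<bullet> b" l] divide_right_mono[of "x \<bullet> b" B l]
      by (auto simp: abs_le_iff minus_le_iff)
    then have "(\<lambda>b\<in>Basis. \<lfloor>x \<bullet> b / l\<rfloor>) \<in> Basis \<rightarrow>\<^sub>E {\<lfloor>- B / l\<rfloor>..\<lfloor>B / l\<rfloor>}"
      by (auto intro!: floor_mono)
    then show "grid l x \<in> (\<lambda>j. \<Sum>b\<in>Basis. of_int (j b) *\<^sub>R b) ` (Basis \<rightarrow>\<^sub>E {\<lfloor>- B / l\<rfloor>..\<lfloor>B / l\<rfloor>})"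
      by (rule rev_image_eqI) (simp add: grid_def)
  qed
  then show ?thesis
    by (rule finite_subset) (intro finite_imageI finite_PiE; simp)
qed

section \<open>Cell averages and the Poincare inequality\<close>

text \<open>A cell lies in a ball around any of its points and contains the open cube of side
  \<open>l\<close> at its lower corner. Finiteness makes cell integrals meaningful, and the lower
  bound controls division by the volume.\<close>

lemma measure_grid_cell:
  fixes x :: "'a::euclidean_space" and l :: real
  assumes "0 < l"
  defines "C \<equiv> grid l -` {grid l x}"
  shows "emeasure lborel C < \<infinity>" and "l ^ DIM('a) \<le> measure lborel C"
proof -
  have C [measurable]: "C \<in> sets borel"
    unfolding C_def using measurable_sets[OF grid_measurable[of l], of "{grid l x}"] by simp
  have "C \<subseteq> ball x ((DIM('a) + 1) * l)"
    using dist_less_if_grid_eq[OF _ assms(1), of x] by (auto simp: C_def)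
  then have "emeasure lborel C \<le> emeasure lborel (ball x ((DIM('a) + 1) * l))"
    by (rule emeasure_mono) simp
  also have "\<dots> < \<infinity>"
    by (intro emeasure_bounded_finite bounded_ball)
  finally show fin: "emeasure lborel C < \<infinity>" .
  define p where "p = l *\<^sub>R grid l x"
  have sub: "box p (p + l *\<^sub>R One) \<subseteq> C"
  proof
    fix y assume y: "y \<in> box p (p + l *\<^sub>R One)"
    have "\<lfloor>y \<bullet> b / l\<rfloor> = \<lfloor>x \<bullet> b / l\<rfloor>" if b: "b \<in> Basis" for b
    proof -
      have "l * of_int \<lfloor>x \<bullet> b / l\<rfloor> < y \<bullet> b" "y \<bullet> b < l * of_int \<lfloor>x \<bullet> b / l\<rfloor> + l"
        using y b by (auto simp: mem_box p_def inner_add_left grid_inner)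
      then show ?thesis
        using \<open>0 < l\<close> by (intro floor_unique) (simp_all add: field_simps)
    qed
    then show "y \<in> C"
      by (simp add: C_def grid_def)
  qed
  have "l ^ DIM('a) = measure lborel (box p (p + l *\<^sub>R One))"
    using \<open>0 < l\<close> by (subst measure_lborel_box) (auto simp: inner_add_left)
  also have "\<dots> \<le> measure lborel C"
    using sub fin by (intro measure_mono_fmeasurable) (auto simp: fmeasurable_def)
  finally show "l ^ DIM('a) \<le> measure lborel C" .
qed

text \<open>Both claims come from |w| \<le> 1 + w^2 on \<open>Q\<close>. The resulting bound is
  crude but uniform over norm-bounded families, which is what confines the cell integrals to
  finitely many codes later.\<close>

lemma integrable_mult_indicator_finite:
  fixes w :: "'a::euclidean_space \<Rightarrow> real"
  assumes "square_integrable w" and [measurable]: "Q \<in> sets borel" and "emeasure lborel Q < \<infinity>"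
  shows "integrable lborel (\<lambda>x. w x * indicator Q x)"
    and "\<bar>\<integral>x. w x * indicator Q x \<partial>lborel\<bar> \<le> measure lborel Q + (\<integral>x. (w x)\<^sup>2 \<partial>lborel)"
proof -
  have [measurable]: "w \<in> borel_measurable borel" and w2: "integrable lborel (\<lambda>x. (w x)\<^sup>2)"
    using assms(1) by (auto simp: square_integrable_def)
  have int: "integrable lborel (\<lambda>x. indicator Q x + (w x)\<^sup>2)"
    using assms w2 by (auto simp: integrable_indicator_iff)
  have le: "norm (w x * indicator Q x) \<le> indicator Q x + (w x)\<^sup>2" for x
  proof -
    have "2 * \<bar>w x\<bar> \<le> 1 + (w x)\<^sup>2"
      using sum_squares_bound[of 1 "\<bar>w x\<bar>"] by simp
    then show ?thesis by (auto split: split_indicator)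
  qed
  show int_w: "integrable lborel (\<lambda>x. w x * indicator Q x)"
    by (rule Bochner_Integration.integrable_bound[OF int]) (use le in \<open>auto intro: order_trans\<close>)
  have "\<bar>\<integral>x. w x * indicator Q x \<partial>lborel\<bar> \<le> (\<integral>x. norm (w x * indicator Q x) \<partial>lborel)"
    using integral_norm_bound[of lborel "\<lambda>x. w x * indicator Q x"] by simp
  also have "\<dots> \<le> (\<integral>x. indicator Q x + (w x)\<^sup>2 \<partial>lborel)"
    by (intro integral_mono integrable_norm int_w int le)
  also have "\<dots> = measure lborel Q + (\<integral>x. (w x)\<^sup>2 \<partial>lborel)"
    using assms w2 by (subst Bochner_Integration.integral_add) (auto simp: integrable_indicator_iff)
  finally show "\<bar>\<integral>x. w x * indicator Q x \<partial>lborel\<bar> \<le> measure lborel Q + (\<integral>x. (w x)\<^sup>2 \<partial>lborel)" .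
qed

text \<open>Expanding the square and integrating over both variables in \<open>Q\<close> gives
  \<open>2 * m * A - 2 * B\<^sup>2\<close>, the variance formula. It acts as a Poincare inequality
  with explicit constant: once the mean is controlled, only the oscillation inside \<open>Q\<close>
  remains.\<close>

lemma variance_identity:
  fixes w :: "'a::euclidean_space \<Rightarrow> real"
  assumes "square_integrable w" and [measurable]: "Q \<in> sets borel" and fin: "emeasure lborel Q < \<infinity>"
    and pos: "0 < measure lborel Q"
  shows "(\<integral>\<^sup>+x. ennreal ((w x)\<^sup>2) * indicator Q x \<partial>lborel) =
    ennreal ((\<integral>x. w x * indicator Q x \<partial>lborel)\<^sup>2 / measure lborel Q) +
    ennreal (1 / (2 * measure lborel Q)) *
      (\<integral>\<^sup>+x. \<integral>\<^sup>+y. ennreal ((w x - w y)\<^sup>2) * (indicator Q x * indicator Q y) \<partial>lborel \<partial>lborel)"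
proof -
  define m where "m = measure lborel Q"
  define B where "B = (\<integral>x. w x * indicator Q x \<partial>lborel)"
  define A where "A = (\<integral>x. (w x)\<^sup>2 * indicator Q x \<partial>lborel)"
  have [measurable]: "w \<in> borel_measurable borel" and w2: "integrable lborel (\<lambda>x. (w x)\<^sup>2)"
    using assms(1) by (auto simp: square_integrable_def)
  have i1: "integrable lborel (\<lambda>x. indicator Q x :: real)"
    using fin by (simp add: integrable_indicator_iff)
  have i2: "integrable lborel (\<lambda>x. w x * indicator Q x)"
    by (rule integrable_mult_indicator_finite) (use assms in auto)
  have i3: "integrable lborel (\<lambda>x. (w x)\<^sup>2 * indicator Q x)"
    using integrable_mult_indicator[OF _ w2, of Q] by (simp add: mult.commute)
  have quad: "integrable lborel (\<lambda>y. (r - w y)\<^sup>2 * indicator Q y)"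
    "(\<integral>y. (r - w y)\<^sup>2 * indicator Q y \<partial>lborel) = r\<^sup>2 * m - 2 * r * B + A" for r
  proof -
    have eq: "(\<lambda>y. (r - w y)\<^sup>2 * indicator Q y) =
        (\<lambda>y. r\<^sup>2 * indicator Q y - 2 * r * (w y * indicator Q y) + (w y)\<^sup>2 * indicator Q y)"
      by (simp add: fun_eq_iff power2_diff algebra_simps)
    show "integrable lborel (\<lambda>y. (r - w y)\<^sup>2 * indicator Q y)"
      unfolding eq using i1 i2 i3 by simp
    show "(\<integral>y. (r - w y)\<^sup>2 * indicator Q y \<partial>lborel) = r\<^sup>2 * m - 2 * r * B + A"
      unfolding eq using i1 i2 i3 by (simp add: m_def B_def A_def)
  qed
  have nonneg: "0 \<le> r\<^sup>2 * m - 2 * r * B + A" for r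
    unfolding quad(2)[symmetric] by (rule Bochner_Integration.integral_nonneg) simp
  have inner: "(\<integral>\<^sup>+y. ennreal ((w x - w y)\<^sup>2) * indicator Q y \<partial>lborel)
      = ennreal ((w x)\<^sup>2 * m - 2 * w x * B + A)" for x
  proof -
    have "(\<integral>\<^sup>+y. ennreal ((w x - w y)\<^sup>2) * indicator Q y \<partial>lborel)
        = (\<integral>\<^sup>+y. ennreal ((w x - w y)\<^sup>2 * indicator Q y) \<partial>lborel)"
      by (intro nn_integral_cong) (simp split: split_indicator)
    also have "\<dots> = ennreal ((w x)\<^sup>2 * m - 2 * w x * B + A)"
      unfolding quad(2)[symmetric] by (intro nn_integral_eq_integral quad(1)) simp
    finally show ?thesis .
  qed
  have "(\<integral>\<^sup>+x. \<integral>\<^sup>+y. ennreal ((w x - w y)\<^sup>2) * (indicator Q x * indicator Q y) \<partial>lborel \<partial>lborel)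
      = (\<integral>\<^sup>+x. (\<integral>\<^sup>+y. ennreal ((w x - w y)\<^sup>2) * indicator Q y \<partial>lborel) * indicator Q x \<partial>lborel)"
    by (intro nn_integral_cong) (simp split: split_indicator)
  also have "\<dots> = (\<integral>\<^sup>+x. ennreal (m * ((w x)\<^sup>2 * indicator Q x) - 2 * B * (w x * indicator Q x) + A * indicator Q x) \<partial>lborel)"
    unfolding inner by (intro nn_integral_cong) (simp split: split_indicator add: algebra_simps)
  also have "\<dots> = ennreal (\<integral>x. m * ((w x)\<^sup>2 * indicator Q x) - 2 * B * (w x * indicator Q x) + A * indicator Q x \<partial>lborel)"
  proof (intro nn_integral_eq_integral AE_I2)
    show "integrable lborel (\<lambda>x. m * ((w x)\<^sup>2 * indicator Q x) - 2 * B * (w x * indicator Q x) + A * indicator Q x)"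
      using i1 i2 i3 by simp
    show "0 \<le> m * ((w x)\<^sup>2 * indicator Q x) - 2 * B * (w x * indicator Q x) + A * indicator Q x" for x
      using nonneg[of "w x"] by (simp split: split_indicator add: algebra_simps)
  qed
  also have "(\<integral>x. m * ((w x)\<^sup>2 * indicator Q x) - 2 * B * (w x * indicator Q x) + A * indicator Q x \<partial>lborel)
      = 2 * m * A - 2 * B\<^sup>2"
    using i1 i2 i3 by (simp add: m_def[symmetric] B_def[symmetric] A_def[symmetric])
      (simp add: power2_eq_square)
  finally have double: "(\<integral>\<^sup>+x. \<integral>\<^sup>+y. ennreal ((w x - w y)\<^sup>2) * (indicator Q x * indicator Q y) \<partial>lborel \<partial>lborel)
      = ennreal (2 * m * A - 2 * B\<^sup>2)" .
  have "0 < m" using pos by (simp add: m_def)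
  \<comment> \<open>The quadratic polynomial in \<open>r\<close> is nonnegative as the integral of a
    square, and its minimum is at the mean \<open>B / m\<close>. This is Cauchy-Schwarz on
    \<open>Q\<close>.\<close>
  have "B\<^sup>2 / m \<le> A"
    using nonneg[of "B / m"] \<open>0 < m\<close> by (simp add: power2_eq_square field_simps)
  then have "0 \<le> 2 * m * A - 2 * B\<^sup>2"
    using \<open>0 < m\<close> by (simp add: field_simps)
  have "(\<integral>\<^sup>+x. ennreal ((w x)\<^sup>2) * indicator Q x \<partial>lborel) = (\<integral>\<^sup>+x. ennreal ((w x)\<^sup>2 * indicator Q x) \<partial>lborel)"
    by (intro nn_integral_cong) (simp split: split_indicator)
  also have "\<dots> = ennreal A"
    unfolding A_def using i3 by (intro nn_integral_eq_integral) auto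
  also have "A = B\<^sup>2 / m + 1 / (2 * m) * (2 * m * A - 2 * B\<^sup>2)"
    using \<open>0 < m\<close> by (simp add: field_simps)
  also have "ennreal \<dots> = ennreal (B\<^sup>2 / m) + ennreal (1 / (2 * m)) * ennreal (2 * m * A - 2 * B\<^sup>2)"
  proof -
    have "ennreal (1 / (2 * m)) * ennreal (2 * m * A - 2 * B\<^sup>2) = ennreal (1 / (2 * m) * (2 * m * A - 2 * B\<^sup>2))"
      using \<open>0 < m\<close> \<open>0 \<le> 2 * m * A - 2 * B\<^sup>2\<close> by (intro ennreal_mult[symmetric]) auto
    then show ?thesis
      using \<open>0 < m\<close> \<open>0 \<le> 2 * m * A - 2 * B\<^sup>2\<close> by (metis ennreal_plus less_imp_le
        mult_nonneg_nonneg divide_nonneg_nonneg zero_le_power2 zero_le_numeral zero_le_one)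
  qed
  finally show ?thesis
    unfolding double by (simp add: m_def B_def)
qed

text \<open>The cells meeting \<Omega> cover the support up to a null set, and the variance identity
  applies on each. The double integrals over distinct cells involve disjoint sets of pairs, all
  closer than the cell diameter bound, so together they are part of one oscillation
  integral.\<close>

lemma grid_poincare:
  fixes w :: "'a::euclidean_space \<Rightarrow> real" and l :: real
  assumes w: "square_integrable w" and supp: "AE x in lborel. x \<notin> \<Omega> \<longrightarrow> w x = 0"
    and "bounded \<Omega>" and l: "0 < l"
  shows "(\<integral>\<^sup>+x. ennreal ((w x)\<^sup>2) \<partial>lborel) \<le> ennreal (1 / l ^ DIM('a)) *
    (ennreal (\<Sum>j\<in>grid l ` \<Omega>. (\<integral>x. w x * indicator (grid l -` {j}) x \<partial>lborel)\<^sup>2)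
      + osc w ((DIM('a) + 1) * l))"
proof -
  define J where "J = grid l ` \<Omega>"
  define C where "C j = grid l -` {j}" for j :: 'a
  define B where "B j = (\<integral>x. w x * indicator (C j) x \<partial>lborel)" for j
  define V where "V j = (\<integral>\<^sup>+x. \<integral>\<^sup>+y. ennreal ((w x - w y)\<^sup>2) * (indicator (C j) x * indicator (C j) y) \<partial>lborel \<partial>lborel)" for j
  have fin: "finite J"
    unfolding J_def using assms by (intro finite_grid_image)
  have [measurable]: "w \<in> borel_measurable borel"
    using w by (auto simp: square_integrable_def)
  have C [measurable]: "C j \<in> sets borel" for j
    unfolding C_def using measurable_sets[OF grid_measurable[of l], of "{j}"] by simp
  have cell: "(\<integral>\<^sup>+x. ennreal ((w x)\<^sup>2) * indicator (C j) x \<partial>lborel)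
      \<le> ennreal (1 / l ^ DIM('a)) * (ennreal ((B j)\<^sup>2) + V j)" if j: "j \<in> J" for j
  proof -
    obtain x where x: "j = grid l x" using j by (auto simp: J_def)
    define m where "m = measure lborel (C j)"
    have m: "emeasure lborel (C j) < \<infinity>" "l ^ DIM('a) \<le> m"
      using measure_grid_cell[OF l, of x] by (simp_all add: C_def x m_def)
    have "0 < l ^ DIM('a)" using l by simp
    with m have "0 < m" by linarith
    have "(\<integral>\<^sup>+x. ennreal ((w x)\<^sup>2) * indicator (C j) x \<partial>lborel)
        = ennreal ((B j)\<^sup>2 / m) + ennreal (1 / (2 * m)) * V j"
      unfolding B_def V_def m_def
      by (rule variance_identity) (use w m \<open>0 < m\<close> in \<open>auto simp: m_def\<close>)
    also have "\<dots> \<le> ennreal (1 / l ^ DIM('a) * (B j)\<^sup>2) + ennreal (1 / l ^ DIM('a)) * V j"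
      using m \<open>0 < m\<close> \<open>0 < l ^ DIM('a)\<close>
      by (intro add_mono ennreal_leI mult_right_mono) (auto simp: field_simps intro!: mult_right_mono)
    also have "\<dots> = ennreal (1 / l ^ DIM('a)) * (ennreal ((B j)\<^sup>2) + V j)"
      unfolding distrib_left using l by (subst ennreal_mult) auto
    finally show ?thesis .
  qed
  have "AE x in lborel. ennreal ((w x)\<^sup>2) \<le> (\<Sum>j\<in>J. ennreal ((w x)\<^sup>2) * indicator (C j) x)"
    using supp
  proof eventually_elim
    case (elim x)
    show ?case
    proof (cases "x \<in> \<Omega>")
      case True
      then have "ennreal ((w x)\<^sup>2) * indicator (C (grid l x)) x \<le> (\<Sum>j\<in>J. ennreal ((w x)\<^sup>2) * indicator (C j) x)"
        by (intro member_le_sum fin) (auto simp: J_def)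
      then show ?thesis by (simp add: C_def)
    qed (use elim in simp)
  qed
  then have "(\<integral>\<^sup>+x. ennreal ((w x)\<^sup>2) \<partial>lborel) \<le> (\<integral>\<^sup>+x. (\<Sum>j\<in>J. ennreal ((w x)\<^sup>2) * indicator (C j) x) \<partial>lborel)"
    by (rule nn_integral_mono_AE)
  also have "\<dots> = (\<Sum>j\<in>J. \<integral>\<^sup>+x. ennreal ((w x)\<^sup>2) * indicator (C j) x \<partial>lborel)"
    by (simp add: nn_integral_sum)
  also have "\<dots> \<le> (\<Sum>j\<in>J. ennreal (1 / l ^ DIM('a)) * (ennreal ((B j)\<^sup>2) + V j))"
    by (intro sum_mono cell)
  also have "\<dots> = ennreal (1 / l ^ DIM('a)) * (ennreal (\<Sum>j\<in>J. (B j)\<^sup>2) + (\<Sum>j\<in>J. V j))"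
    by (simp add: sum.distrib flip: sum_distrib_left)
  also have "(\<Sum>j\<in>J. V j) \<le> osc w ((DIM('a) + 1) * l)"
  proof -
    have "(\<Sum>j\<in>J. V j) = (\<integral>\<^sup>+x. \<integral>\<^sup>+y. (\<Sum>j\<in>J. ennreal ((w x - w y)\<^sup>2) * (indicator (C j) x * indicator (C j) y)) \<partial>lborel \<partial>lborel)"
      unfolding V_def by (simp add: nn_integral_sum lborel.borel_measurable_nn_integral)
    also have "\<dots> \<le> osc w ((DIM('a) + 1) * l)"
      unfolding osc_def
    proof (intro nn_integral_mono)
      fix x y :: 'a
      \<comment> \<open>For a given pair at most the index of the cell of \<open>x\<close>
        contributes, and only if \<open>y\<close> shares that cell.\<close>
      have "(\<Sum>j\<in>J. ennreal ((w x - w y)\<^sup>2) * (indicator (C j) x * indicator (C j) y))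
          = (\<Sum>j\<in>J. if j = grid l x then (if grid l x = grid l y then ennreal ((w x - w y)\<^sup>2) else 0) else 0)"
        by (intro sum.cong) (auto simp: C_def split: split_indicator)
      also have "\<dots> \<le> (if grid l x = grid l y then ennreal ((w x - w y)\<^sup>2) else 0)"
        using fin by simp
      also have "\<dots> \<le> (if dist x y < (DIM('a) + 1) * l then ennreal ((w x - w y)\<^sup>2) else 0)"
        using dist_less_if_grid_eq[OF _ l, of x y] by auto
      finally show "(\<Sum>j\<in>J. ennreal ((w x - w y)\<^sup>2) * (indicator (C j) x * indicator (C j) y))
          \<le> (if dist x y < (DIM('a) + 1) * l then ennreal ((w x - w y)\<^sup>2) else 0)" .
    qed
    finally show ?thesis .
  qed
  finally show ?thesis
    by (simp add: J_def B_def C_def mult_left_mono add_mono)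
qed

text \<open>Each function is encoded by its cell integrals rounded down to multiples of
  \<open>\<theta>\<close>. The norm bound leaves finitely many codes, and functions with equal codes
  are closer than \<open>e\<close> by \<open>grid_poincare\<close> applied to their
  difference.\<close>

lemma L2_on_totally_bounded:
  fixes \<Omega> :: "'a::euclidean_space set"
  assumes "bounded \<Omega>" and A: "A \<subseteq> L2_on \<Omega>" and M: "\<And>u. u \<in> A \<Longrightarrow> norm u \<le> M"
    and osc: "\<And>\<eta>. 0 < \<eta> \<Longrightarrow> \<exists>t>0. \<forall>u\<in>A. osc (L2_fun u) t \<le> ennreal (\<eta> * t ^ DIM('a))"
    and e: "0 < e"
  shows "\<exists>k. finite k \<and> k \<subseteq> A \<and> A \<subseteq> (\<Union>x\<in>k. ball x e)"
proof -
  define N where "N = DIM('a)"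
  \<comment> \<open>The oscillation of a difference is at most \<open>4 * \<eta> * t ^ N\<close>.
    With \<open>t = (N + 1) * l\<close> this is \<open>e\<^sup>2 * l ^ N / 4\<close>, half of the
    permitted total \<open>e\<^sup>2 * l ^ N / 2\<close>.\<close>
  define \<eta> where "\<eta> = e\<^sup>2 / (16 * real (N + 1) ^ N)"
  have "0 < \<eta>" using e by (simp add: \<eta>_def)
  then obtain t where t: "0 < t" and osc_t: "\<And>u. u \<in> A \<Longrightarrow> osc (L2_fun u) t \<le> ennreal (\<eta> * t ^ N)"
    using osc unfolding N_def by blast
  define l where "l = t / real (N + 1)"
  have l: "0 < l" "(DIM('a) + 1) * l = t"
    using t by (simp_all add: l_def N_def del: of_nat_Suc of_nat_add)
  define J where "J = grid l ` \<Omega>"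
  have fin: "finite J"
    unfolding J_def using assms l by (intro finite_grid_image)
  define C where "C j = grid l -` {j}" for j :: 'a
  define B where "B u j = (\<integral>x. L2_fun u x * indicator (C j) x \<partial>lborel)" for u j
  have C [measurable]: "C j \<in> sets borel" for j
    unfolding C_def using measurable_sets[OF grid_measurable[of l], of "{j}"] by simp
  have C_fin: "emeasure lborel (C j) < \<infinity>" if "j \<in> J" for j
    using that measure_grid_cell[OF l(1)] by (auto simp: J_def C_def)
  \<comment> \<open>Chosen so that \<open>card J\<close> squared errors of size
    \<open>\<theta>\<close> fill the other half of that total. The added 1 keeps
    \<open>\<theta>\<close> positive even for empty \<open>J\<close>.\<close>
  define \<theta> where "\<theta> = sqrt (e\<^sup>2 * l ^ N / (4 * real (card J + 1)))"
  have \<theta>: "0 < \<theta>" "\<theta>\<^sup>2 = e\<^sup>2 * l ^ N / (4 * real (card J + 1))"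
    using e l by (simp_all add: \<theta>_def)
  define R where "R j = (measure lborel (C j) + M\<^sup>2) / \<theta>" for j
  define code where "code u = (\<lambda>j\<in>J. \<lfloor>B u j / \<theta>\<rfloor>)" for u
  have B_le: "\<bar>B u j\<bar> \<le> measure lborel (C j) + M\<^sup>2" if "u \<in> A" "j \<in> J" for u j
  proof -
    have "\<bar>B u j\<bar> \<le> measure lborel (C j) + (norm u)\<^sup>2"
      unfolding B_def norm_L2_sq using that C_fin
      by (intro integrable_mult_indicator_finite square_integrable_L2_fun) auto
    also have "(norm u)\<^sup>2 \<le> M\<^sup>2"
      using M[OF that(1)] by (intro power_mono) auto
    finally show ?thesis by simp
  qed
  have "code ` A \<subseteq> (\<Pi>\<^sub>E j\<in>J. {\<lfloor>- R j\<rfloor>..\<lfloor>R j\<rfloor>})"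
  proof (intro image_subsetI PiE_I)
    fix u j assume "u \<in> A" "j \<in> J"
    then have "- R j \<le> B u j / \<theta>" "B u j / \<theta> \<le> R j"
      using B_le[of u j] divide_right_mono[of _ _ \<theta>] \<theta>(1) unfolding R_def minus_divide_left
      by (auto simp: abs_le_iff minus_le_iff simp del: minus_divide_left)
    then show "code u j \<in> {\<lfloor>- R j\<rfloor>..\<lfloor>R j\<rfloor>}"
      using \<open>j \<in> J\<close> by (simp add: code_def floor_mono)
  qed (simp add: code_def)
  then have "finite (code ` A)"
    by (rule finite_subset) (intro finite_PiE fin; simp)
  \<comment> \<open>One member of \<open>A\<close> per code serves as a centre. Centres taken from
    \<open>A\<close> itself inherit its oscillation bound.\<close>
  then obtain k where k: "k \<subseteq> A" "finite k" "code ` A = code ` k"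
    using finite_subset_image[of "code ` A" code A] by blast
  have "A \<subseteq> (\<Union>x\<in>k. ball x e)"
  proof
    fix u assume u: "u \<in> A"
    then obtain v where v: "v \<in> k" "code u = code v"
      using k by blast
    then have "v \<in> A" using k by blast
    define w where "w x = L2_fun u x - L2_fun v x" for x
    have w: "square_integrable w"
      unfolding w_def by (intro square_integrable_diff square_integrable_L2_fun)
    have supp: "AE x in lborel. x \<notin> \<Omega> \<longrightarrow> w x = 0"
      using subsetD[OF A u] subsetD[OF A \<open>v \<in> A\<close>] unfolding L2_on_def mem_Collect_eq
      by eventually_elim (simp add: w_def)
    have diff: "\<bar>\<integral>x. w x * indicator (C j) x \<partial>lborel\<bar> \<le> \<theta>" if "j \<in> J" for j
    proof -
      have "(\<integral>x. w x * indicator (C j) x \<partial>lborel) = B u j - B v j"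
        unfolding B_def w_def left_diff_distrib using that C_fin
        by (intro Bochner_Integration.integral_diff integrable_mult_indicator_finite square_integrable_L2_fun) auto
      moreover have "\<lfloor>B u j / \<theta>\<rfloor> = \<lfloor>B v j / \<theta>\<rfloor>"
        using fun_cong[OF v(2), of j] that by (simp add: code_def)
      then have "\<bar>B u j / \<theta> - B v j / \<theta>\<bar> \<le> 1"
        by linarith
      then have "\<bar>B u j - B v j\<bar> \<le> \<theta>"
        using \<theta>(1) by (simp add: diff_divide_distrib[symmetric] abs_divide)
      ultimately show ?thesis by simp
    qed
    have "(\<Sum>j\<in>J. (\<integral>x. w x * indicator (C j) x \<partial>lborel)\<^sup>2) \<le> (\<Sum>j\<in>J. \<theta>\<^sup>2)"
      using power_mono[OF diff abs_ge_zero, of _ 2] by (intro sum_mono) simp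
    also have "\<dots> \<le> real (card J + 1) * \<theta>\<^sup>2"
      by (simp add: mult_right_mono)
    also have "\<dots> = e\<^sup>2 * l ^ N / 4"
      unfolding \<theta> by (simp add: field_simps del: of_nat_Suc of_nat_add)
    finally have sum_le: "(\<Sum>j\<in>J. (\<integral>x. w x * indicator (C j) x \<partial>lborel)\<^sup>2) \<le> e\<^sup>2 * l ^ N / 4" .
    have "osc w t \<le> 2 * osc (L2_fun u) t + 2 * osc (L2_fun v) t"
      unfolding w_def by (intro osc_diff) measurable
    also have "\<dots> \<le> 2 * ennreal (\<eta> * t ^ N) + 2 * ennreal (\<eta> * t ^ N)"
      using osc_t u \<open>v \<in> A\<close> by (intro add_mono mult_left_mono) auto
    also have "\<dots> = ennreal (2 * (\<eta> * t ^ N) + 2 * (\<eta> * t ^ N))"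
    proof -
      have "2 * ennreal (\<eta> * t ^ N) = ennreal (2 * (\<eta> * t ^ N))"
        using \<open>0 < \<eta>\<close> t by (simp add: ennreal_mult)
      then show ?thesis
        using \<open>0 < \<eta>\<close> t by (metis ennreal_plus less_imp_le mult_nonneg_nonneg zero_le_numeral zero_le_power)
    qed
    also have "2 * (\<eta> * t ^ N) + 2 * (\<eta> * t ^ N) = e\<^sup>2 * l ^ N / 4"
      by (simp add: \<eta>_def l_def power_divide ac_simps)
    finally have osc_le: "osc w t \<le> ennreal (e\<^sup>2 * l ^ N / 4)" .
    have "ennreal ((norm (u - v))\<^sup>2) = (\<integral>\<^sup>+x. ennreal ((w x)\<^sup>2) \<partial>lborel)"
      by (simp add: ennreal_norm_L2_minus_sq w_def)
    also have "\<dots> \<le> ennreal (1 / l ^ N) *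
        (ennreal (\<Sum>j\<in>J. (\<integral>x. w x * indicator (C j) x \<partial>lborel)\<^sup>2) + osc w t)"
      using grid_poincare[OF w supp \<open>bounded \<Omega>\<close> l(1)] unfolding l(2) J_def C_def N_def .
    also have "\<dots> \<le> ennreal (1 / l ^ N) * (ennreal (e\<^sup>2 * l ^ N / 4) + ennreal (e\<^sup>2 * l ^ N / 4))"
      by (intro mult_left_mono add_mono ennreal_leI sum_le osc_le) simp
    also have "ennreal (e\<^sup>2 * l ^ N / 4) + ennreal (e\<^sup>2 * l ^ N / 4) = ennreal (e\<^sup>2 * l ^ N / 4 + e\<^sup>2 * l ^ N / 4)"
      using l by (intro ennreal_plus[symmetric]) auto
    also have "ennreal (1 / l ^ N) * \<dots> = ennreal (1 / l ^ N * (e\<^sup>2 * l ^ N / 4 + e\<^sup>2 * l ^ N / 4))"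
      using l by (intro ennreal_mult[symmetric]) auto
    also have "1 / l ^ N * (e\<^sup>2 * l ^ N / 4 + e\<^sup>2 * l ^ N / 4) = e\<^sup>2 / 2"
      using l by (simp add: field_simps)
    finally have "(norm (u - v))\<^sup>2 \<le> e\<^sup>2 / 2"
      using e by (simp add: ennreal_le_iff)
    also have "\<dots> < e\<^sup>2" using e by simp
    finally have "norm (u - v) < e"
      using e by (simp add: power2_less_imp_less)
    then show "u \<in> (\<Union>x\<in>k. ball x e)"
      using v by (auto simp: dist_norm norm_minus_commute)
  qed
  then show ?thesis using k by blast
qed

section \<open>Gagliardo seminorms of Lipschitz functions\<close>

text \<open>With \<open>z = (2 - 2 * s) * ln 2\<close> the ratio is exp(-z) \<le> 1 / (1 + z). For
  \<open>s\<close> at least 1/2 one has 1 - s \<le> z \<le> 1, so one minus the ratio is at least (1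
  - s) / 2.\<close>

lemma suminf_geometric_powr_le:
  fixes s :: real
  assumes "1 / 2 \<le> s" "s < 1"
  shows "(\<Sum>k. (2 powr (2 * s - 2)) ^ k) \<le> 2 / (1 - s)"
    and "summable (\<lambda>k. ((2::real) powr (2 * s - 2)) ^ k)"
proof -
  define q where "q = (2::real) powr (2 * s - 2)"
  define z where "z = (2 - 2 * s) * ln 2"
  have q: "0 < q" "q < 1" using assms by (auto simp: q_def powr_less_one)
  have "(2 - 2 * s) * (1 / 2) \<le> z"
    unfolding z_def using ln2_ge_two_thirds assms by (intro mult_left_mono) auto
  then have z: "1 - s \<le> z" by simp
  have "z \<le> (2 - 2 * s) * 1"
    unfolding z_def using ln_2_less_1 assms by (intro mult_left_mono) auto
  then have "z \<le> 1" using assms by simp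
  have "q = 1 / exp z"
    by (simp add: q_def z_def powr_def exp_minus[symmetric] inverse_eq_divide[symmetric] algebra_simps)
  also have "\<dots> \<le> 1 / (1 + z)"
    using z assms exp_ge_add_one_self[of z] by (intro divide_left_mono) auto
  finally have "(1 - q) \<ge> z / (1 + z)"
    using z assms by (simp add: field_simps)
  moreover have "z / (1 + z) \<ge> (1 - s) / 2"
    using z \<open>z \<le> 1\<close> assms by (intro frac_le) auto
  ultimately have "(1 - s) / 2 \<le> 1 - q" by linarith
  then have "1 / (1 - q) \<le> 2 / (1 - s)"
    using q assms by (simp add: field_simps)
  then show "(\<Sum>k. (2 powr (2 * s - 2)) ^ k) \<le> 2 / (1 - s)"
    using q suminf_geometric[of q] by (simp add: q_def)
  show "summable (\<lambda>k. ((2::real) powr (2 * s - 2)) ^ k)"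
    using q by (intro summable_geometric) (simp add: q_def)
qed

lemma dyadic_bracket_small:
  fixes d :: real
  assumes "0 < d" "d < 1"
  obtains k where "1 / 2 ^ Suc k \<le> d" "d < 1 / 2 ^ k"
proof -
  have ex: "\<exists>n. 1 / 2 ^ n \<le> d"
    using real_arch_pow_inv[of d "1 / 2"] assms by (auto simp: power_one_over intro: less_imp_le)
  define n where "n = (LEAST n. 1 / 2 ^ n \<le> d)"
  have n: "1 / 2 ^ n \<le> d" unfolding n_def using ex by (rule LeastI_ex)
  then obtain k where "n = Suc k" using assms by (cases n) auto
  moreover have "\<not> 1 / 2 ^ k \<le> d"
    using not_less_Least[of k "\<lambda>n. 1 / 2 ^ n \<le> d"] \<open>n = Suc k\<close> by (simp add: n_def)
  ultimately show ?thesis using n that by simp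
qed

lemma dyadic_bracket_large:
  fixes d :: real
  assumes "1 \<le> d"
  obtains k where "2 ^ k \<le> d" "d < 2 ^ Suc k"
proof -
  have ex: "\<exists>n. d < 2 ^ n" using real_arch_pow[of 2 d] by simp
  define n where "n = (LEAST n. d < 2 ^ n)"
  have n: "d < 2 ^ n" unfolding n_def using ex by (rule LeastI_ex)
  then obtain k where "n = Suc k" using assms by (cases n) auto
  moreover have "\<not> d < 2 ^ k"
    using not_less_Least[of k "\<lambda>n. d < 2 ^ n"] \<open>n = Suc k\<close> by (simp add: n_def)
  ultimately show ?thesis using n that[of k] by simp
qed

lemma ennreal_suminf_component: "f k \<le> (\<Sum>i. f i)" for f :: "nat \<Rightarrow> ennreal"
  using sum_le_suminf[of f "{k}"] by simp

text \<open>A substitute for polar coordinates: a radially decaying integrand is dominated by a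
  countable sum of constants on balls. The separate majorant \<open>b\<close> lets applications
  supply a plain geometric series.\<close>

lemma nn_integral_dyadic_balls_le:
  fixes x :: "'a::euclidean_space"
  assumes cover: "\<And>y. g y \<noteq> 0 \<Longrightarrow> \<exists>k. y \<in> ball x (r k) \<and> g y \<le> ennreal (a k)"
    and r: "\<And>k. 0 \<le> r k" "\<And>k. 0 \<le> a k"
    and bound: "\<And>k. a k * r k ^ DIM('a) \<le> b k" and b: "summable b"
  shows "(\<integral>\<^sup>+y. g y \<partial>lborel) \<le> ennreal (unit_ball_vol DIM('a) * (\<Sum>k::nat. b k))"
proof -
  have b0: "0 \<le> b k" for k
    using bound[of k] r[of k] by (meson mult_nonneg_nonneg order_trans zero_le_power)
  have "g y \<le> (\<Sum>k. ennreal (a k) * indicator (ball x (r k)) y)" for y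
  proof (cases "g y = 0")
    case False
    then obtain k where k: "y \<in> ball x (r k)" "g y \<le> ennreal (a k)"
      using cover by blast
    have "ennreal (a k) * indicator (ball x (r k)) y \<le> (\<Sum>k. ennreal (a k) * indicator (ball x (r k)) y)"
      by (rule ennreal_suminf_component)
    with k show ?thesis by simp
  qed simp
  then have "(\<integral>\<^sup>+y. g y \<partial>lborel) \<le> (\<integral>\<^sup>+y. (\<Sum>k. ennreal (a k) * indicator (ball x (r k)) y) \<partial>lborel)"
    by (intro nn_integral_mono)
  also have "\<dots> = (\<Sum>k. ennreal (a k) * emeasure lborel (ball x (r k)))"
  proof -
    have [measurable]: "ball x (r k) \<in> sets borel" for k by simp
    show ?thesis
      by (subst nn_integral_suminf, measurable) (simp add: nn_integral_cmult_indicator)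
  qed
  also have "\<dots> \<le> (\<Sum>k. ennreal (unit_ball_vol DIM('a) * b k))"
  proof (intro suminf_le allI)
    fix k
    have "ennreal (a k) * emeasure lborel (ball x (r k)) = ennreal (unit_ball_vol DIM('a) * (a k * r k ^ DIM('a)))"
      using r by (simp add: emeasure_ball ennreal_mult[symmetric] mult_ac)
    also have "\<dots> \<le> ennreal (unit_ball_vol DIM('a) * b k)"
      using bound by (intro ennreal_leI mult_left_mono) auto
    finally show "ennreal (a k) * emeasure lborel (ball x (r k)) \<le> ennreal (unit_ball_vol DIM('a) * b k)" .
  qed auto
  also have "\<dots> = ennreal (unit_ball_vol DIM('a) * (\<Sum>k. b k))"
    using b b0 by (subst suminf_ennreal2) (auto simp: suminf_mult summable_mult)
  finally show ?thesis .
qed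

text \<open>The 2 in the exponent is what a Lipschitz function contributes against the singularity.
  On the shell at distance about 2^-k the integrand is at most \<open>q ^ k\<close> times a factor
  compensated by the ball volume, and the sum over \<open>k\<close> produces 1 / (1 - s).\<close>

lemma nn_integral_near_le:
  fixes x :: "'a::euclidean_space"
  assumes s: "1 / 2 \<le> s" "s < 1"
  shows "(\<integral>\<^sup>+y. ennreal (if dist x y < 1 then dist x y powr (2 - (real DIM('a) + 2 * s)) else 0) \<partial>lborel)
    \<le> ennreal (unit_ball_vol DIM('a) * (2 ^ DIM('a) * (2 / (1 - s))))"
proof -
  define q where "q = (2::real) powr (2 * s - 2)"
  have q: "summable (\<lambda>k. q ^ k)" "(\<Sum>k. q ^ k) \<le> 2 / (1 - s)"
    using suminf_geometric_powr_le[OF s] by (auto simp: q_def)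
  have "0 < q" by (simp add: q_def)
  have "(\<integral>\<^sup>+y. ennreal (if dist x y < 1 then dist x y powr (2 - (real DIM('a) + 2 * s)) else 0) \<partial>lborel)
      \<le> ennreal (unit_ball_vol DIM('a) * (\<Sum>k. 2 ^ DIM('a) * q ^ k))"
  proof (rule nn_integral_dyadic_balls_le[where r = "\<lambda>k. 1 / 2 ^ k" and a = "\<lambda>k. q ^ k * (2 ^ Suc k) ^ DIM('a)"])
    fix y
    assume "ennreal (if dist x y < 1 then dist x y powr (2 - (real DIM('a) + 2 * s)) else 0) \<noteq> 0"
    then have d: "0 < dist x y" "dist x y < 1"
      by (auto split: if_splits)
    then obtain k where k: "1 / 2 ^ Suc k \<le> dist x y" "dist x y < 1 / 2 ^ k"
      by (rule dyadic_bracket_small)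
    have "dist x y powr (2 - (real DIM('a) + 2 * s)) = dist x y powr (2 - 2 * s) * dist x y powr (- real DIM('a))"
      by (simp add: algebra_simps flip: powr_add)
    also have "\<dots> \<le> (1 / 2 ^ k) powr (2 - 2 * s) * (1 / 2 ^ Suc k) powr (- real DIM('a))"
      using k d s by (intro mult_mono powr_mono2 powr_mono2') auto
    also have "(1 / 2 ^ k) powr (2 - 2 * s) = q ^ k"
    proof -
      have "(1 / 2 ^ k) powr (2 - 2 * s) = (2 powr (- real k)) powr (2 - 2 * s)"
        by (simp add: powr_minus powr_realpow inverse_eq_divide)
      also have "\<dots> = q ^ k"
        by (simp add: q_def powr_powr powr_power algebra_simps)
      finally show ?thesis .
    qed
    also have "(1 / 2 ^ Suc k) powr (- real DIM('a)) = ((2::real) ^ Suc k) ^ DIM('a)"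
      by (subst powr_minus, subst powr_realpow) (auto simp: power_one_over)
    finally show "\<exists>k. y \<in> ball x (1 / 2 ^ k) \<and>
        ennreal (if dist x y < 1 then dist x y powr (2 - (real DIM('a) + 2 * s)) else 0)
          \<le> ennreal (q ^ k * (2 ^ Suc k) ^ DIM('a))"
      using k d by (intro exI[of _ k]) (auto intro!: ennreal_leI)
  qed (use q \<open>0 < q\<close> in \<open>auto simp: power_mult_distrib power_divide intro: summable_mult\<close>)
  also have "(\<Sum>k. 2 ^ DIM('a) * q ^ k) = 2 ^ DIM('a) * (\<Sum>k. q ^ k)"
    using q by (simp add: suminf_mult)
  also have "ennreal (unit_ball_vol DIM('a) * \<dots>) \<le> ennreal (unit_ball_vol DIM('a) * (2 ^ DIM('a) * (2 / (1 - s))))"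
    using q by (intro ennreal_leI mult_left_mono) auto
  finally show ?thesis .
qed

text \<open>For \<open>s\<close> at least 1/2 and distance at least 1 the kernel decays at least
  like the power -(N + 1). Each doubling of the distance then gains a factor 1/2 after volumes are
  counted, uniformly in \<open>s\<close>.\<close>

lemma nn_integral_far_le:
  fixes x :: "'a::euclidean_space"
  assumes s: "1 / 2 \<le> s"
  shows "(\<integral>\<^sup>+y. ennreal (if dist x y < 1 then 0 else dist x y powr (- (real DIM('a) + 2 * s))) \<partial>lborel)
    \<le> ennreal (unit_ball_vol DIM('a) * (2 ^ DIM('a) * 2))"
proof -
  have "(\<integral>\<^sup>+y. ennreal (if dist x y < 1 then 0 else dist x y powr (- (real DIM('a) + 2 * s))) \<partial>lborel)
      \<le> ennreal (unit_ball_vol DIM('a) * (\<Sum>k. 2 ^ DIM('a) * (1 / 2) ^ k))"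
  proof (rule nn_integral_dyadic_balls_le[where r = "\<lambda>k. 2 ^ Suc k" and a = "\<lambda>k. 1 / (2 ^ k) ^ Suc DIM('a)"])
    fix y
    assume "ennreal (if dist x y < 1 then 0 else dist x y powr (- (real DIM('a) + 2 * s))) \<noteq> 0"
    then have d: "1 \<le> dist x y"
      by (auto split: if_splits)
    then obtain k where k: "2 ^ k \<le> dist x y" "dist x y < 2 ^ Suc k"
      by (rule dyadic_bracket_large)
    have "dist x y powr (- (real DIM('a) + 2 * s)) \<le> dist x y powr (- real (Suc DIM('a)))"
      using d s by (intro powr_mono) auto
    also have "\<dots> \<le> (2 ^ k) powr (- real (Suc DIM('a)))"
      using k by (intro powr_mono2') auto
    also have "\<dots> = 1 / (2 ^ k) ^ Suc DIM('a)"
      by (subst powr_minus, subst powr_realpow) (auto simp: divide_inverse)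
    finally show "\<exists>k. y \<in> ball x (2 ^ Suc k) \<and>
        ennreal (if dist x y < 1 then 0 else dist x y powr (- (real DIM('a) + 2 * s)))
          \<le> ennreal (1 / (2 ^ k) ^ Suc DIM('a))"
      using k d by (intro exI[of _ k]) (auto intro!: ennreal_leI)
  next
    show "summable (\<lambda>k. 2 ^ DIM('a) * (1 / 2 :: real) ^ k)"
      by (intro summable_mult summable_geometric) simp
  qed (auto simp: power_mult_distrib power_one_over)
  also have "(\<Sum>k. 2 ^ DIM('a) * (1 / 2) ^ k) = 2 ^ DIM('a) * (2::real)"
    by (subst suminf_mult) (auto simp: suminf_geometric summable_geometric)
  finally show ?thesis .
qed

text \<open>The Lipschitz bound handles pairs at distance below 1 and boundedness the others. A pair
  contributes only if one of its points lies in \<open>S\<close>, so one integration runs over a set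
  of finite measure.\<close>

lemma gagliardo_lipschitz_le:
  fixes f :: "'a::euclidean_space \<Rightarrow> real"
  assumes f [measurable]: "f \<in> borel_measurable borel"
    and lip: "\<And>x y. \<bar>f x - f y\<bar> \<le> L * dist x y"
    and bdd: "\<And>x y. \<bar>f x - f y\<bar> \<le> B"
    and S [measurable]: "S \<in> sets borel" and S_fin: "emeasure lborel S < \<infinity>"
    and supp: "\<And>x. x \<notin> S \<Longrightarrow> f x = 0"
  obtains A where "0 < A" "\<And>s. 1 / 2 \<le> s \<Longrightarrow> s < 1 \<Longrightarrow> gagliardo s f \<le> ennreal (A / (1 - s))"
proof -
  define N where "N = real DIM('a)"
  define c where "c = unit_ball_vol N * 2 ^ DIM('a) * 2"
  have c: "0 < c" by (simp add: c_def N_def)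
  define m where "m = measure lborel S"
  have m: "emeasure lborel S = ennreal m" "0 \<le> m"
    using S_fin by (simp_all add: m_def emeasure_eq_ennreal_measure less_top)
  \<comment> \<open>The 2 counts which of the two points lies in \<open>S\<close>. The added 1 makes
    \<open>A\<close> positive, since it becomes a denominator in the lower bound for
    \<open>c\<close>.\<close>
  define A where "A = 2 * m * (L\<^sup>2 + B\<^sup>2) * c + 1"
  have bound: "gagliardo s f \<le> ennreal (A / (1 - s))" if s: "1 / 2 \<le> s" "s < 1" for s
  proof -
    define g where "g x y = L\<^sup>2 * (if dist x y < 1 then dist x y powr (2 - (N + 2 * s)) else 0)
      + B\<^sup>2 * (if dist x y < 1 then 0 else dist x y powr (- (N + 2 * s)))" for x y :: 'a
    have g0: "0 \<le> g x y" for x y by (simp add: g_def)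
    have [measurable]: "(\<lambda>(x, y). g x y) \<in> borel_measurable (lborel \<Otimes>\<^sub>M lborel)"
      unfolding g_def by measurable
    have [measurable]: "g x \<in> borel_measurable borel" for x
      unfolding g_def by measurable
    have int_g: "(\<integral>\<^sup>+y. ennreal (g x y) \<partial>lborel) \<le> ennreal ((L\<^sup>2 + B\<^sup>2) * c / (1 - s))" for x
    proof -
      have "(\<integral>\<^sup>+y. ennreal (g x y) \<partial>lborel)
          = ennreal (L\<^sup>2) * (\<integral>\<^sup>+y. ennreal (if dist x y < 1 then dist x y powr (2 - (N + 2 * s)) else 0) \<partial>lborel)
          + ennreal (B\<^sup>2) * (\<integral>\<^sup>+y. ennreal (if dist x y < 1 then 0 else dist x y powr (- (N + 2 * s))) \<partial>lborel)"
        unfolding g_def by (simp add: ennreal_mult nn_integral_add nn_integral_cmult)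
      also have "\<dots> \<le> ennreal (L\<^sup>2) * ennreal (c / (1 - s)) + ennreal (B\<^sup>2) * ennreal c"
        using nn_integral_near_le[OF s, of x] nn_integral_far_le[OF s(1), of x]
        unfolding N_def c_def by (intro add_mono mult_left_mono) (simp_all add: mult_ac)
      also have "\<dots> \<le> ennreal (L\<^sup>2) * ennreal (c / (1 - s)) + ennreal (B\<^sup>2) * ennreal (c / (1 - s))"
        using c s by (intro add_mono mult_left_mono ennreal_leI) (auto simp: field_simps)
      also have "\<dots> = ennreal (L\<^sup>2 * (c / (1 - s)) + B\<^sup>2 * (c / (1 - s)))"
      proof -
        have X: "0 \<le> c / (1 - s)" using c s by simp
        show ?thesis
          unfolding ennreal_mult[OF zero_le_power2 X, symmetric]
          by (rule ennreal_plus[symmetric]) (intro mult_nonneg_nonneg zero_le_power2 X)+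
      qed
      also have "L\<^sup>2 * (c / (1 - s)) + B\<^sup>2 * (c / (1 - s)) = (L\<^sup>2 + B\<^sup>2) * c / (1 - s)"
        by (simp add: add_divide_distrib distrib_right)
      finally show ?thesis .
    qed
    have pt: "ennreal ((f x - f y)\<^sup>2 / norm (x - y) powr (N + 2 * s))
        \<le> indicator S x * ennreal (g x y) + indicator S y * ennreal (g y x)" for x y
    proof -
      have sym: "g y x = g x y" by (simp add: g_def dist_commute)
      have le: "(f x - f y)\<^sup>2 / norm (x - y) powr (N + 2 * s) \<le> g x y"
      proof (cases "x = y")
        case False
        define d where "d = dist x y"
        have d: "0 < d" using False by (simp add: d_def)
        show ?thesis
        proof (cases "d < 1")
          case True
          have "(f x - f y)\<^sup>2 \<le> (L * d)\<^sup>2"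
            using power_mono[OF lip abs_ge_zero, of x y 2] by (simp add: d_def)
          then have "(f x - f y)\<^sup>2 / d powr (N + 2 * s) \<le> (L * d)\<^sup>2 / d powr (N + 2 * s)"
            by (intro divide_right_mono) auto
          also have "\<dots> = L\<^sup>2 * d powr (2 - (N + 2 * s))"
            using d by (simp add: powr_diff power_mult_distrib)
          finally show ?thesis using True by (simp add: g_def d_def dist_norm)
        next
          case False
          have "(f x - f y)\<^sup>2 \<le> B\<^sup>2"
            using power_mono[OF bdd abs_ge_zero, of x y 2] by simp
          then have "(f x - f y)\<^sup>2 / d powr (N + 2 * s) \<le> B\<^sup>2 / d powr (N + 2 * s)"
            by (intro divide_right_mono) auto
          also have "\<dots> = B\<^sup>2 * d powr (- (N + 2 * s))"
            by (simp add: powr_minus divide_inverse del: minus_add_distrib)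
          finally show ?thesis using False by (simp add: g_def d_def dist_norm)
        qed
      qed (simp add: g_def)
      show ?thesis
      proof (cases "x \<in> S \<or> y \<in> S")
        case True
        then show ?thesis
          using ennreal_leI[OF le] sym by (auto split: split_indicator intro: order_trans add_increasing2)
      qed (simp add: supp)
    qed
    have "gagliardo s f \<le> (\<integral>\<^sup>+x. \<integral>\<^sup>+y. indicator S x * ennreal (g x y) + indicator S y * ennreal (g y x) \<partial>lborel \<partial>lborel)"
      unfolding gagliardo_def N_def[symmetric] by (intro nn_integral_mono pt)
    also have "\<dots> = (\<integral>\<^sup>+x. \<integral>\<^sup>+y. indicator S x * ennreal (g x y) \<partial>lborel \<partial>lborel)
        + (\<integral>\<^sup>+x. \<integral>\<^sup>+y. indicator S y * ennreal (g y x) \<partial>lborel \<partial>lborel)"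
      by (simp add: nn_integral_add lborel.borel_measurable_nn_integral)
    also have "(\<integral>\<^sup>+x. \<integral>\<^sup>+y. indicator S y * ennreal (g y x) \<partial>lborel \<partial>lborel)
        = (\<integral>\<^sup>+y. \<integral>\<^sup>+x. indicator S y * ennreal (g y x) \<partial>lborel \<partial>lborel)"
      by (rule lborel_pair.Fubini') measurable
    also have "(\<integral>\<^sup>+x. \<integral>\<^sup>+y. indicator S x * ennreal (g x y) \<partial>lborel \<partial>lborel) + \<dots>
        = 2 * (\<integral>\<^sup>+x. indicator S x * (\<integral>\<^sup>+y. ennreal (g x y) \<partial>lborel) \<partial>lborel)"
      by (simp add: nn_integral_cmult mult_2)
    also have "\<dots> \<le> 2 * (\<integral>\<^sup>+x. indicator S x * ennreal ((L\<^sup>2 + B\<^sup>2) * c / (1 - s)) \<partial>lborel)"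
      by (intro mult_left_mono nn_integral_mono int_g) auto
    also have "\<dots> = 2 * (ennreal m * ennreal ((L\<^sup>2 + B\<^sup>2) * c / (1 - s)))"
      by (simp add: nn_integral_multc m)
    also have "\<dots> = ennreal (2 * (m * ((L\<^sup>2 + B\<^sup>2) * c / (1 - s))))"
    proof -
      have X: "0 \<le> (L\<^sup>2 + B\<^sup>2) * c / (1 - s)" using c s by simp
      show ?thesis
        by (simp only: ennreal_mult[OF zero_le_numeral mult_nonneg_nonneg[OF m(2) X]]
          ennreal_mult[OF m(2) X] ennreal_numeral)
    qed
    also have "\<dots> \<le> ennreal (A / (1 - s))"
      using s by (intro ennreal_leI) (simp add: A_def field_simps)
    finally show ?thesis .
  qed
  have "0 < A"
    unfolding A_def using m c by (intro add_nonneg_pos mult_nonneg_nonneg) auto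
  then show ?thesis using bound that by blast
qed

section \<open>From the double integral to the iterated one\<close>

lemma nn_integral_gagliardo_kernel:
  "(\<integral>\<^sup>+z. ennreal (gagliardo_kernel s u z) \<partial>(lborel \<Otimes>\<^sub>M lborel)) = gagliardo s (L2_fun u)"
proof -
  have "(\<lambda>z. ennreal (gagliardo_kernel s u z)) \<in> borel_measurable (lborel \<Otimes>\<^sub>M lborel)"
    unfolding gagliardo_kernel_def by measurable
  then show ?thesis
    by (subst lborel.nn_integral_fst[symmetric]) (auto simp: gagliardo_def gagliardo_kernel_def)
qed

text \<open>This holds also for infinite seminorm: the Bochner integral is then 0 by convention, and
  so is \<open>enn2real\<close> of infinity.\<close>

lemma integral_gagliardo_kernel:
  "(\<integral>z. gagliardo_kernel s u z \<partial>(lborel \<Otimes>\<^sub>M lborel)) = enn2real (gagliardo s (L2_fun u))"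
proof -
  have "gagliardo_kernel s u \<in> borel_measurable (lborel \<Otimes>\<^sub>M lborel)"
    unfolding gagliardo_kernel_def by measurable
  then show ?thesis
    unfolding nn_integral_gagliardo_kernel[symmetric]
    by (intro integral_eq_nn_integral) (auto simp: gagliardo_kernel_def)
qed

lemma gagliardo_cong_AE:
  assumes "AE x in lborel. f x = g x"
  shows "gagliardo s f = gagliardo s g"
  unfolding gagliardo_def
proof (intro nn_integral_cong_AE)
  show "AE x in lborel. (\<integral>\<^sup>+y. ennreal ((f x - f y)\<^sup>2 / norm (x - y) powr (real DIM('a) + 2 * s)) \<partial>lborel)
      = (\<integral>\<^sup>+y. ennreal ((g x - g y)\<^sup>2 / norm (x - y) powr (real DIM('a) + 2 * s)) \<partial>lborel)"
    using assms
  proof eventually_elim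
    case (elim x)
    show ?case
      by (intro nn_integral_cong_AE) (use assms in \<open>auto simp: elim elim!: eventually_mono\<close>)
  qed
qed

section \<open>The normalization constants\<close>

lemma integrable_continuous_compact_support:
  fixes f :: "'a::euclidean_space \<Rightarrow> real"
  assumes "continuous_on UNIV f" "\<And>x. x \<notin> S \<Longrightarrow> f x = 0" "compact S"
  shows "integrable lborel f"
proof -
  have "integrable lborel (\<lambda>x. indicator S x *\<^sub>R f x)"
    by (rule borel_integrable_compact[OF assms(3) continuous_on_subset[OF assms(1) subset_UNIV]])
  also have "(\<lambda>x. indicator S x *\<^sub>R f x) = f"
    using assms(2) by (auto simp: fun_eq_iff split: split_indicator)
  finally show ?thesis .
qed

text \<open>By translation invariance every difference quotient has integral 0. Dominated
  convergence passes this to the derivative, with no need to split off a coordinate.\<close>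

lemma integral_directional_derivative_eq_0:
  fixes f :: "'a::euclidean_space \<Rightarrow> real"
  assumes deriv: "\<And>x. (f has_derivative f' x) (at x)"
    and cont: "continuous_on UNIV (\<lambda>x. f' x b)"
    and supp: "\<And>x. x \<notin> cball p r \<Longrightarrow> f x = 0" "\<And>x. x \<notin> cball p r \<Longrightarrow> f' x b = 0"
    and b: "norm b \<le> 1"
  shows "(\<integral>x. f' x b \<partial>lborel) = 0"
proof -
  \<comment> \<open>Steps of length at most 1 along a vector of norm at most 1 keep all quotients
    supported in the ball of radius \<open>r + 1\<close>, where one constant dominates them by the
    mean value theorem.\<close>
  define h where "h n = 1 / (real n + 1)" for n
  have h: "0 < h n" "h n \<le> 1" for n by (auto simp: h_def)
  have f_cont: "continuous_on UNIV f"
    using deriv by (meson continuous_at_imp_continuous_on has_derivative_continuous)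
  then have [measurable]: "f \<in> borel_measurable borel"
    by (rule borel_measurable_continuous_onI)
  have f_int: "integrable lborel f"
    by (rule integrable_continuous_compact_support[OF f_cont supp(1) compact_cball])
  have "bounded ((\<lambda>x. f' x b) ` cball p r)"
    by (intro compact_imp_bounded compact_continuous_image continuous_on_subset[OF cont]) auto
  then obtain B0 where B0: "\<And>x. x \<in> cball p r \<Longrightarrow> \<bar>f' x b\<bar> \<le> B0"
    unfolding bounded_iff by (metis imageI real_norm_def)
  define B where "B = max 0 B0"
  have B: "\<bar>f' x b\<bar> \<le> B" for x
    using B0[of x] supp(2)[of x] by (cases "x \<in> cball p r") (auto simp: B_def)
  have line: "((\<lambda>t. f (x + t *\<^sub>R b)) has_real_derivative f' (x + t *\<^sub>R b) b) (at t)" for x t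
  proof -
    have "((\<lambda>t. f (x + t *\<^sub>R b)) has_derivative (\<lambda>v. f' (x + t *\<^sub>R b) (v *\<^sub>R b))) (at t)"
      by (rule has_derivative_compose[OF _ deriv]) (auto intro!: derivative_eq_intros)
    moreover have "f' y (v *\<^sub>R b) = f' y b * v" for y v
      using has_derivative_linear[OF deriv[of y]] by (simp add: linear_scale mult.commute)
    ultimately show ?thesis
      unfolding has_field_derivative_def by simp
  qed
  define d where "d n x = (f (h n *\<^sub>R b + x) - f x) / h n" for n x
  have lim: "(\<lambda>n. d n x) \<longlonglongrightarrow> f' x b" for x
  proof -
    have "((\<lambda>t. (f (x + t *\<^sub>R b) - f x) / t) \<longlongrightarrow> f' x b) (at 0)"
      using line[of x 0] by (simp add: DERIV_def)
    moreover have "filterlim h (at 0) sequentially"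
      unfolding filterlim_at
      using h(1) LIMSEQ_inverse_real_of_nat
      by (auto simp: h_def[abs_def] inverse_eq_divide less_imp_neq[THEN not_sym] add.commute)
    ultimately show ?thesis
      unfolding d_def by (auto dest: filterlim_compose simp: add.commute)
  qed
  have bound: "norm (d n x) \<le> B * indicator (cball p (r + 1)) x" for n x
  proof (cases "x \<in> cball p (r + 1)")
    case True
    obtain z where "f (x + h n *\<^sub>R b) - f (x + 0 *\<^sub>R b) = (h n - 0) * f' (x + z *\<^sub>R b) b"
      using MVT2[OF h(1)[of n], of "\<lambda>t. f (x + t *\<^sub>R b)" "\<lambda>t. f' (x + t *\<^sub>R b) b"] line by blast
    then have "d n x = f' (x + z *\<^sub>R b) b"
      using h(1)[of n] by (simp add: d_def add.commute)
    then show ?thesis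
      using B True by simp
  next
    case False
    have "norm (h n *\<^sub>R b) \<le> 1"
      using h[of n] b by (simp add: mult_le_one)
    then have "h n *\<^sub>R b + x \<notin> cball p r" "x \<notin> cball p r"
      using False norm_triangle_ineq2[of "x - p" "- (h n *\<^sub>R b)"]
      by (auto simp: dist_norm norm_minus_commute[of p] algebra_simps)
    then show ?thesis
      using False by (simp add: d_def supp(1))
  qed
  have int_d: "(\<integral>x. d n x \<partial>lborel) = 0" for n
  proof -
    have "(\<integral>x. f x \<partial>lborel) = (\<integral>x. f x \<partial>(distr lborel borel ((+) (h n *\<^sub>R b))))"
      by (simp add: lborel_distr_plus)
    also have "\<dots> = (\<integral>x. f (h n *\<^sub>R b + x) \<partial>lborel)"
      by (intro integral_distr) auto
    finally have eq: "(\<integral>x. f (h n *\<^sub>R b + x) \<partial>lborel) = (\<integral>x. f x \<partial>lborel)" ..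
    have "integrable (distr lborel borel ((+) (h n *\<^sub>R b))) f"
      using f_int by (simp add: lborel_distr_plus)
    then have "integrable lborel (\<lambda>x. f (h n *\<^sub>R b + x))"
      by (subst (asm) integrable_distr_eq) auto
    then show ?thesis
      using f_int eq by (simp add: d_def)
  qed
  have "(\<lambda>n. \<integral>x. d n x \<partial>lborel) \<longlonglongrightarrow> (\<integral>x. f' x b \<partial>lborel)"
  proof (rule integral_dominated_convergence)
    show "integrable lborel (\<lambda>x. B * indicator (cball p (r + 1)) x)"
      using emeasure_bounded_finite[OF bounded_cball, of p "r + 1"]
      by (intro integrable_mult_right) (simp add: integrable_indicator_iff)
    show "(\<lambda>x. f' x b) \<in> borel_measurable lborel"
      using borel_measurable_continuous_onI[OF cont] by simp
    show "d n \<in> borel_measurable lborel" for n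
      unfolding d_def by measurable
  qed (use lim bound in auto)
  then show ?thesis
    by (simp add: int_d LIMSEQ_const_iff)
qed

text \<open>The product of \<open>f\<close> with a test function is differentiable with support in
  the same ball, so the integral of its directional derivative vanishes. The product rule turns this
  into the defining identity.\<close>

lemma has_weak_gradient_L2_class:
  fixes f :: "'a::euclidean_space \<Rightarrow> real"
  assumes deriv: "\<And>x. (f has_derivative (\<lambda>v. G x \<bullet> v)) (at x)"
    and G: "continuous_on UNIV G"
    and supp: "\<And>x. x \<notin> cball p r \<Longrightarrow> f x = 0" "\<And>x. x \<notin> cball p r \<Longrightarrow> G x = 0"
  shows "square_integrable f" "has_weak_gradient (L2_class f) G"
proof -
  have f_cont: "continuous_on UNIV f"
    using deriv by (meson continuous_at_imp_continuous_on has_derivative_continuous)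
  then have [measurable]: "f \<in> borel_measurable borel"
    by (rule borel_measurable_continuous_onI)
  show f: "square_integrable f"
    unfolding square_integrable_def
    by (intro conjI integrable_continuous_compact_support[of _ "cball p r"] continuous_intros f_cont)
      (auto simp: supp)
  have parts: "(\<integral>x. L2_fun (L2_class f) x * frechet_derivative \<phi> (at x) b \<partial>lborel) =
      - (\<integral>x. (G x \<bullet> b) * \<phi> x \<partial>lborel)" if \<phi>: "test_function \<phi>" and b: "b \<in> Basis" for \<phi> b
  proof -
    define D where "D x = frechet_derivative \<phi> (at x)" for x
    have "C_k (Suc 0) \<phi>" using \<phi> unfolding test_function_def by blast
    then have \<phi>_deriv: "(\<phi> has_derivative D x) (at x)" and D_cont: "continuous_on UNIV (\<lambda>x. D x v)" for x v
      by (auto simp: D_def frechet_derivative_works)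
    have \<phi>_cont: "continuous_on UNIV \<phi>"
      using \<phi>_deriv by (meson continuous_at_imp_continuous_on has_derivative_continuous)
    have int1: "integrable lborel (\<lambda>x. f x * D x b)" and int2: "integrable lborel (\<lambda>x. (G x \<bullet> b) * \<phi> x)"
      by (intro integrable_continuous_compact_support[of _ "cball p r"] continuous_intros f_cont D_cont G \<phi>_cont;
          simp add: supp)+
    have "(\<integral>x. f x * D x b + (G x \<bullet> b) * \<phi> x \<partial>lborel) = 0"
    proof (rule integral_directional_derivative_eq_0[where f = "\<lambda>x. f x * \<phi> x" and p = p and r = r])
      show "((\<lambda>x. f x * \<phi> x) has_derivative (\<lambda>v. f x * D x v + (G x \<bullet> v) * \<phi> x)) (at x)" for x
        by (rule has_derivative_mult[OF deriv \<phi>_deriv])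
      show "continuous_on UNIV (\<lambda>x. f x * D x b + (G x \<bullet> b) * \<phi> x)"
        by (intro continuous_intros f_cont D_cont G \<phi>_cont)
    qed (use b in \<open>auto simp: supp\<close>)
    then have "(\<integral>x. f x * D x b \<partial>lborel) = - (\<integral>x. (G x \<bullet> b) * \<phi> x \<partial>lborel)"
      using int1 int2 by simp
    moreover have "(\<integral>x. L2_fun (L2_class f) x * D x b \<partial>lborel) = (\<integral>x. f x * D x b \<partial>lborel)"
      using L2_class_inverse_AE[OF f] borel_measurable_continuous_onI[OF D_cont]
      by (intro integral_cong_AE) (auto elim!: eventually_mono)
    ultimately show ?thesis by (simp add: D_def)
  qed
  have "integrable lborel (\<lambda>x. (norm (G x))\<^sup>2)"
    by (intro integrable_continuous_compact_support[of _ "cball p r"] continuous_intros G) (auto simp: supp)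
  then show "has_weak_gradient (L2_class f) G"
    unfolding has_weak_gradient_def using parts borel_measurable_continuous_onI[OF G] by blast
qed

section \<open>An explicit bump function\<close>

text \<open>Squaring the positive part makes the gradient continuous across the sphere, so an
  explicit piecewise polynomial of class C^1 does the work of a smooth cutoff.\<close>

definition bump :: "'a::euclidean_space \<Rightarrow> real \<Rightarrow> 'a \<Rightarrow> real" where
  "bump p r x = (max 0 (r\<^sup>2 - (norm (x - p))\<^sup>2))\<^sup>2"

definition bump_grad :: "'a::euclidean_space \<Rightarrow> real \<Rightarrow> 'a \<Rightarrow> 'a" where
  "bump_grad p r x = (- 4 * max 0 (r\<^sup>2 - (norm (x - p))\<^sup>2)) *\<^sub>R (x - p)"

lemma has_real_derivative_max_0_sq: "((\<lambda>t::real. (max 0 t)\<^sup>2) has_real_derivative 2 * max 0 t) (at t)"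
proof -
  have le: "\<bar>((max 0 (t + h))\<^sup>2 - (max 0 t)\<^sup>2) / h - 2 * max 0 t\<bar> \<le> \<bar>h\<bar>" if "h \<noteq> 0" for h
  proof -
    have "\<bar>(max 0 (t + h))\<^sup>2 - (max 0 t)\<^sup>2 - 2 * max 0 t * h\<bar> \<le> h\<^sup>2"
    proof (cases "0 \<le> t"; cases "0 \<le> t + h")
      assume "0 \<le> t" "0 \<le> t + h"
      then show ?thesis by (simp add: power2_eq_square algebra_simps)
    next
      assume a: "0 \<le> t" "\<not> 0 \<le> t + h"
      \<comment> \<open>With \<open>t + h\<close> negative the remainder is
        \<open>t * (- t - 2 * h)\<close>, and it falls short of \<open>h\<^sup>2\<close> by exactly
        \<open>(t + h)\<^sup>2\<close>.\<close>
      have "(t + h)\<^sup>2 \<ge> 0" "t * (- t - 2 * h) \<ge> 0"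
        using a by (auto intro: mult_nonneg_nonneg)
      with a show ?thesis by (auto simp: power2_eq_square algebra_simps abs_le_iff)
    next
      assume a: "\<not> 0 \<le> t" "0 \<le> t + h"
      then have "(t + h)\<^sup>2 \<le> h\<^sup>2" by (intro power_mono) auto
      with a show ?thesis by simp
    qed auto
    then have "\<bar>(max 0 (t + h))\<^sup>2 - (max 0 t)\<^sup>2 - 2 * max 0 t * h\<bar> / \<bar>h\<bar> \<le> h\<^sup>2 / \<bar>h\<bar>"
      by (intro divide_right_mono) auto
    also have "h\<^sup>2 / \<bar>h\<bar> = \<bar>h\<bar>"
      using that by (simp add: power2_eq_square divide_eq_eq flip: abs_mult)
    also have "\<bar>(max 0 (t + h))\<^sup>2 - (max 0 t)\<^sup>2 - 2 * max 0 t * h\<bar> / \<bar>h\<bar>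
        = \<bar>((max 0 (t + h))\<^sup>2 - (max 0 t)\<^sup>2) / h - 2 * max 0 t\<bar>"
      using that by (simp add: diff_divide_distrib flip: abs_divide)
    finally show ?thesis .
  qed
  have "((\<lambda>h. ((max 0 (t + h))\<^sup>2 - (max 0 t)\<^sup>2) / h - 2 * max 0 t) \<longlongrightarrow> 0) (at 0)"
    by (rule Lim_null_comparison[of _ "\<lambda>h. \<bar>h\<bar>"])
      (use le in \<open>auto simp: eventually_at_filter intro!: tendsto_rabs_zero tendsto_ident_at\<close>)
  then show ?thesis
    unfolding DERIV_def by (rule Lim_null[THEN iffD2])
qed

lemma bump_has_derivative: "(bump p r has_derivative (\<lambda>v. bump_grad p r x \<bullet> v)) (at x)"
proof -
  have eq: "bump p r = (\<lambda>x. (\<lambda>t. (max 0 t)\<^sup>2) (r\<^sup>2 - (x - p) \<bullet> (x - p)))"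
    by (simp add: bump_def fun_eq_iff power2_norm_eq_inner)
  have "((\<lambda>x. r\<^sup>2 - (x - p) \<bullet> (x - p)) has_derivative (\<lambda>v. - 2 * ((x - p) \<bullet> v))) (at x)"
    by (auto intro!: derivative_eq_intros simp: inner_commute)
  from has_derivative_compose[OF this has_real_derivative_max_0_sq[unfolded has_field_derivative_def]]
  show ?thesis
    unfolding eq by (simp add: bump_grad_def power2_norm_eq_inner mult.assoc)
qed

lemma bump_eq_0: "x \<notin> cball p r \<Longrightarrow> 0 < r \<Longrightarrow> bump p r x = 0"
  and bump_grad_eq_0: "x \<notin> ball p r \<Longrightarrow> 0 < r \<Longrightarrow> bump_grad p r x = 0"
  by (auto simp: bump_def bump_grad_def dist_norm norm_minus_commute[of p] max_def not_less
      dest: power_mono[of r "norm (x - p)" 2])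

lemma norm_bump_grad_le: "0 < r \<Longrightarrow> norm (bump_grad p r x) \<le> 4 * r ^ 3"
proof (cases "x \<in> ball p r")
  case True
  assume "0 < r"
  have "max 0 (r\<^sup>2 - (norm (x - p))\<^sup>2) \<le> r\<^sup>2" by simp
  moreover have "norm (x - p) \<le> r" using True by (simp add: dist_norm norm_minus_commute)
  ultimately have "max 0 (r\<^sup>2 - (norm (x - p))\<^sup>2) * norm (x - p) \<le> r\<^sup>2 * r"
    by (intro mult_mono) auto
  then show ?thesis by (simp add: bump_grad_def abs_mult power3_eq_cube power2_eq_square)
qed (simp add: bump_grad_eq_0)

lemma bump_lipschitz:
  assumes "0 < r" shows "\<bar>bump p r x - bump p r y\<bar> \<le> 4 * r ^ 3 * dist x y"
proof -
  have "norm (bump p r x - bump p r y) \<le> 4 * r ^ 3 * norm (x - y)"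
  proof (rule differentiable_bound[OF convex_UNIV])
    show "(bump p r has_derivative (\<lambda>v. bump_grad p r z \<bullet> v)) (at z within UNIV)" for z
      by (simp add: bump_has_derivative)
    show "onorm (\<lambda>v. bump_grad p r z \<bullet> v) \<le> 4 * r ^ 3" for z
    proof (rule onorm_le)
      fix v
      have "norm (bump_grad p r z \<bullet> v) \<le> norm (bump_grad p r z) * norm v"
        using Cauchy_Schwarz_ineq2 by simp
      also have "\<dots> \<le> 4 * r ^ 3 * norm v"
        using norm_bump_grad_le[OF assms] by (rule mult_right_mono) simp
      finally show "norm (bump_grad p r z \<bullet> v) \<le> 4 * r ^ 3 * norm v" .
    qed
  qed auto
  then show ?thesis by (simp add: dist_norm)
qed

lemma bump_bounds: "0 \<le> bump p r x" "bump p r x \<le> r ^ 4"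
proof -
  have "(max 0 (r\<^sup>2 - (norm (x - p))\<^sup>2))\<^sup>2 \<le> (r\<^sup>2)\<^sup>2"
    by (intro power_mono) auto
  then show "bump p r x \<le> r ^ 4"
    by (simp add: bump_def flip: power_mult)
qed (simp add: bump_def)

text \<open>The energies of a bump inside \<Omega> converge to a positive Dirichlet integral
  \<open>E\<close>, while its squared seminorm is at most \<open>A / (1 - s)\<close>. The constants
  have to make up the difference.\<close>

lemma BBM_normalized_lower_bound:
  fixes \<Omega> :: "'a::euclidean_space set"
  assumes "open \<Omega>" "\<Omega> \<noteq> {}" and c: "BBM_normalized \<Omega> c"
  obtains \<kappa> where "0 < \<kappa>" "\<forall>\<^sub>F s in at_left 1. \<kappa> * (1 - s) \<le> c s"
proof -
  obtain p r where r: "0 < r" and sub: "cball p r \<subseteq> \<Omega>"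
    using assms by (metis all_not_in_conv open_contains_cball)
  define f where "f = bump p r"
  define G where "G = bump_grad p r"
  define u where "u = L2_class f"
  have G_cont: "continuous_on UNIV G"
    unfolding G_def bump_grad_def by (intro continuous_intros)
  have grad: "square_integrable f" "has_weak_gradient u G"
    unfolding u_def f_def G_def
    by (rule has_weak_gradient_L2_class[OF bump_has_derivative G_cont[unfolded G_def], of p r];
        use r in \<open>auto simp: bump_eq_0 bump_grad_eq_0\<close>)+
  have [measurable]: "f \<in> borel_measurable borel"
    using grad by (simp add: square_integrable_def)
  have AE_f: "AE x in lborel. L2_fun u x = f x"
    unfolding u_def by (rule L2_class_inverse_AE[OF grad(1)])
  have u: "u \<in> H10 \<Omega>"
    unfolding H10_def H1_def using grad(2) AE_f sub r
    by (auto elim!: eventually_mono simp: f_def bump_eq_0 subset_eq)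
  define E where "E = (LINT x:\<Omega>|lborel. (norm (G x))\<^sup>2)"
  have "0 < E"
  proof -
    have int: "integrable lborel (\<lambda>x. indicator \<Omega> x *\<^sub>R (norm (G x))\<^sup>2)"
      using grad(2) \<open>open \<Omega>\<close> by (intro integrable_mult_indicator) (auto simp: has_weak_gradient_def)
    have "E \<noteq> 0"
    proof
      assume "E = 0"
      then have "AE x in lborel. indicator \<Omega> x *\<^sub>R (norm (G x))\<^sup>2 = 0"
        unfolding E_def set_lebesgue_integral_def
        using integral_nonneg_eq_0_iff_AE[OF int] by simp
      \<comment> \<open>Inside the open ball the gradient vanishes only at the centre, which is a
        null set.\<close>
      with AE_lborel_singleton[of p] have "AE x in lborel. x \<notin> ball p r"
      proof eventually_elim
        case (elim x)
        show ?case
        proof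
          assume x: "x \<in> ball p r"
          then have "x \<in> \<Omega>" using sub by auto
          then have "G x = 0" using elim by simp
          moreover have "(norm (x - p))\<^sup>2 < r\<^sup>2"
            using x r by (intro power_strict_mono) (auto simp: dist_norm norm_minus_commute)
          ultimately show False
            using elim by (auto simp: G_def bump_grad_def max_def split: if_splits)
        qed
      qed
      then have "emeasure lborel (ball p r) = 0"
        using emeasure_eq_0_AE[of "\<lambda>x. x \<in> ball p r" lborel] by (simp del: mem_ball)
      then show False
        using r unit_ball_vol_pos[of "real DIM('a)"] by (simp add: emeasure_ball)
    qed
    moreover have "0 \<le> E"
      unfolding E_def set_lebesgue_integral_def by (intro integral_nonneg_AE) auto
    ultimately show ?thesis by simp
  qed
  have "\<bar>f x - f y\<bar> \<le> r ^ 4" for x y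
    using bump_bounds[of p r x] bump_bounds[of p r y] by (simp add: f_def abs_le_iff)
  then obtain A where A: "0 < A" "\<And>s. 1 / 2 \<le> s \<Longrightarrow> s < 1 \<Longrightarrow> gagliardo s f \<le> ennreal (A / (1 - s))"
  proof (rule gagliardo_lipschitz_le[rotated 2])
    show "\<bar>f x - f y\<bar> \<le> 4 * r ^ 3 * dist x y" for x y
      unfolding f_def by (rule bump_lipschitz[OF r])
    show "emeasure lborel (cball p r) < \<infinity>"
      by (intro emeasure_bounded_finite bounded_cball)
    show "f x = 0" if "x \<notin> cball p r" for x
      unfolding f_def using that r by (rule bump_eq_0)
  qed auto
  have "((\<lambda>s. frac_energy c s u) \<longlongrightarrow> E) (at_left 1)"
    using c u grad(2) unfolding BBM_normalized_def E_def by blast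
  then have "\<forall>\<^sub>F s in at_left 1. E / 2 < frac_energy c s u"
    using \<open>0 < E\<close> by (intro order_tendstoD) auto
  moreover have "\<forall>\<^sub>F s in at_left 1. s \<in> {1 / 2<..<1 :: real}"
    by (rule eventually_at_leftI[of "1 / 2"]) auto
  \<comment> \<open>The energy eventually exceeds \<open>E / 2\<close> and is at most
    \<open>c s / 2 * (A / (1 - s))\<close>, hence the constant \<open>E / A\<close>.\<close>
  ultimately have "\<forall>\<^sub>F s in at_left 1. E / A * (1 - s) \<le> c s"
  proof eventually_elim
    case (elim s)
    have "0 < c s" using c elim unfolding BBM_normalized_def by auto
    have "gagliardo s (L2_fun u) \<le> ennreal (A / (1 - s))"
      using A(2)[of s] elim gagliardo_cong_AE[OF AE_f, of s] by auto
    then have "enn2real (gagliardo s (L2_fun u)) \<le> A / (1 - s)"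
      using A elim by (intro enn2real_leI) auto
    then have "c s / 2 * enn2real (gagliardo s (L2_fun u)) \<le> c s / 2 * (A / (1 - s))"
      using \<open>0 < c s\<close> by (intro mult_left_mono) auto
    then have "E / 2 < c s / 2 * (A / (1 - s))"
      using elim unfolding frac_energy_def integral_gagliardo_kernel by linarith
    then show ?case
      using elim A(1) by (simp add: field_simps)
  qed
  with \<open>0 < E\<close> A(1) show ?thesis
    by (intro that[of "E / A"]) auto
qed

section \<open>Equicoercivity\<close>

lemma frac_energy_nonneg: "0 \<le> c s \<Longrightarrow> 0 \<le> frac_energy c s u"
  by (simp add: frac_energy_def integral_gagliardo_kernel)

text \<open>Membership in \<open>Hs s\<close> excludes the case where an infinite seminorm hides
  behind the default value 0 of the Bochner integral.\<close>

lemma gagliardo_le_frac_energy: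
  assumes "u \<in> Hs s" "0 < c s" and E: "frac_energy c s u \<le> E"
  shows "gagliardo s (L2_fun u) \<le> ennreal (2 * E / c s)"
proof -
  define I where "I = (\<integral>z. gagliardo_kernel s u z \<partial>(lborel \<Otimes>\<^sub>M lborel))"
  have "gagliardo s (L2_fun u) = ennreal I"
    unfolding nn_integral_gagliardo_kernel[symmetric] I_def
    using assms(1) by (intro nn_integral_eq_integral) (auto simp: Hs_def gagliardo_kernel_def)
  moreover have "I \<le> 2 * E / c s"
    using E assms(2) by (simp add: frac_energy_def I_def field_simps)
  ultimately show ?thesis
    by (simp add: ennreal_leI)
qed

text \<open>In a complete space the closure of a totally bounded set is compact. The radius is
  halved because passing to the closure turns open balls into closed ones.\<close>

lemma relatively_compact_in_closed:
  fixes A :: "'v::complete_space set"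
  assumes "closed X" "A \<subseteq> X" and tb: "\<And>e. 0 < e \<Longrightarrow> \<exists>k. finite k \<and> A \<subseteq> (\<Union>x\<in>k. ball x e)"
  shows "relatively_compact_in X A"
proof -
  have "compact (closure A)"
    unfolding compact_eq_totally_bounded
  proof (intro conjI allI impI)
    show "complete (closure A)" by (simp add: complete_eq_closed)
    fix e :: real assume "0 < e"
    then obtain k where k: "finite k" "A \<subseteq> (\<Union>x\<in>k. ball x (e / 2))"
      using tb[of "e / 2"] by auto
    have "A \<subseteq> (\<Union>x\<in>k. cball x (e / 2))"
      using k(2) ball_subset_cball by blast
    then have "closure A \<subseteq> (\<Union>x\<in>k. cball x (e / 2))"
      using k(1) by (intro closure_minimal closed_UN) auto
    also have "\<dots> \<subseteq> (\<Union>x\<in>k. ball x e)"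
      using \<open>0 < e\<close> by (intro UN_mono) auto
    finally show "\<exists>k. finite k \<and> closure A \<subseteq> (\<Union>x\<in>k. ball x e)"
      using k(1) by blast
  qed
  moreover have "closure A \<subseteq> X"
    using assms by (intro closure_minimal)
  then have "top_of_set X closure_of A = closure A"
    using assms(2) by (auto simp: closure_of_subtopology Int_absorb1)
  ultimately show ?thesis
    using \<open>closure A \<subseteq> X\<close> assms(2) by (simp add: relatively_compact_in_def compactin_subtopology)
qed

theorem theorem5p10:
  fixes \<Omega> :: "'a::euclidean_space set"
    and c :: "real \<Rightarrow> real"
    and K :: "'a L2 \<Rightarrow> 'a L2"
    and y\<delta> :: "'a L2"
    and \<alpha> C :: real
    and s :: "nat \<Rightarrow> real"
    and u :: "nat \<Rightarrow> 'a L2"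
  assumes "bounded_lipschitz_domain \<Omega>"
    and "BBM_normalized \<Omega> c"
    and "bounded_linear_on (L2_on \<Omega>) K"
    and "y\<delta> \<in> L2_on \<Omega>"
    and "\<alpha> > 0"
    and "\<And>n. s n \<in> {0<..<1}"
    and "s \<longlonglongrightarrow> 1"
    and "\<And>n. u n \<in> L2_on \<Omega>"
    and "\<And>n. J_functional \<Omega> c K y\<delta> \<alpha> (s n) (u n) \<le> ereal C"
  shows "relatively_compact_in (L2_on \<Omega>) (range u)"
proof -
  have \<Omega>: "open \<Omega>" "\<Omega> \<noteq> {}" "bounded \<Omega>"
    using assms(1) by (auto simp: bounded_lipschitz_domain_def)
  have s: "0 < s n" "s n < 1" for n
    using assms(6)[of n] by auto
  have c: "0 < c (s n)" for n
    using assms(2,6) by (auto simp: BBM_normalized_def)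
  \<comment> \<open>Dropping the nonnegative fidelity term and dividing by
    \<open>\<alpha> / 2\<close> leaves this bound for squared norm plus energy.\<close>
  define E where "E = 2 * C / \<alpha>"
  have u_Hs: "u n \<in> Hs (s n)" for n
    using assms(9)[of n] by (auto simp: J_functional_def Hs0_def split: if_splits)
  have J: "(norm (u n))\<^sup>2 + frac_energy c (s n) (u n) \<le> E" for n
  proof -
    have "1 / 2 * (norm (K (u n) - y\<delta>))\<^sup>2 + \<alpha> / 2 * ((norm (u n))\<^sup>2 + frac_energy c (s n) (u n)) \<le> C"
      using assms(9)[of n] by (auto simp: J_functional_def split: if_splits)
    moreover have "0 \<le> 1 / 2 * (norm (K (u n) - y\<delta>))\<^sup>2" by simp
    ultimately have "\<alpha> / 2 * ((norm (u n))\<^sup>2 + frac_energy c (s n) (u n)) \<le> C"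
      by linarith
    then show ?thesis
      using \<open>\<alpha> > 0\<close> by (simp add: E_def field_simps)
  qed
  have norm_u: "(norm (u n))\<^sup>2 \<le> E" for n
    using J[of n] frac_energy_nonneg[of c "s n" "u n"] c[of n] by linarith
  have "0 \<le> E"
    using norm_u[of 0] zero_le_power2 by (rule order_trans[rotated])
  have energy: "gagliardo (s n) (L2_fun (u n)) \<le> ennreal (2 * E / c (s n))" for n
    using J[of n] by (intro gagliardo_le_frac_energy u_Hs c) (use zero_le_power2[of "norm (u n)"] in linarith)
  obtain \<kappa> where \<kappa>: "0 < \<kappa>" "\<forall>\<^sub>F \<sigma> in at_left 1. \<kappa> * (1 - \<sigma>) \<le> c \<sigma>"
    using BBM_normalized_lower_bound[OF \<Omega>(1,2) assms(2)] by blast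
  have "filterlim s (at_left 1) sequentially"
    unfolding filterlim_at using assms(7) s by (auto simp: less_imp_neq)
  then have "\<forall>\<^sub>F n in sequentially. \<kappa> * (1 - s n) \<le> c (s n)"
    by (rule eventually_compose_filterlim[OF \<kappa>(2)])
  moreover have "\<forall>\<^sub>F n in sequentially. 1 / 2 < s n"
    using assms(7) by (rule order_tendstoD) simp
  ultimately have "\<forall>\<^sub>F n in sequentially. \<kappa> * (1 - s n) \<le> c (s n) \<and> 1 / 2 < s n"
    by (rule eventually_conj)
  then obtain n0 where n0: "\<And>n. n \<ge> n0 \<Longrightarrow> \<kappa> * (1 - s n) \<le> c (s n)" "\<And>n. n \<ge> n0 \<Longrightarrow> 1 / 2 < s n"
    unfolding eventually_sequentially by blast
  define A where "A = u ` {n0..}"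
  \<comment> \<open>The product of \<open>4 * (1 - s n)\<close> and
    \<open>2 * E / (\<kappa> * (1 - s n))\<close>: here the factor \<open>1 - s n\<close>
    cancels.\<close>
  define Q where "Q = 8 * E / \<kappa>"
  have "0 \<le> Q" using \<open>0 \<le> E\<close> \<kappa> by (simp add: Q_def)
  have osc_u: "osc (L2_fun (u n)) t \<le> ennreal (Q * t * t ^ DIM('a))"
    if n: "n \<ge> n0" and t: "0 < t" "t \<le> 1" for n t
  proof -
    have pos: "0 < \<kappa> * (1 - s n)" using \<kappa> s by simp
    have "osc (L2_fun (u n)) t \<le> ennreal (4 * (1 - s n) * (2 * E / c (s n)) * t powr (real DIM('a) + 2 * s n))"
      using energy[of n] \<open>0 \<le> E\<close> c[of n] by (intro osc_le_gagliardo s t) auto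
    also have "\<dots> \<le> ennreal (Q * t powr (real DIM('a) + 1))"
    proof (intro ennreal_leI mult_mono)
      have "4 * (1 - s n) * (2 * E / c (s n)) \<le> 4 * (1 - s n) * (2 * E / (\<kappa> * (1 - s n)))"
        using n0(1)[OF n] pos \<open>0 \<le> E\<close> s[of n] by (intro mult_left_mono divide_left_mono) auto
      also have "\<dots> = Q"
      proof -
        have "4 * d * (2 * E / (\<kappa> * d)) = Q" if "d \<noteq> 0" for d
          using that by (simp add: Q_def)
        from this[of "1 - s n"] show ?thesis using s[of n] by linarith
      qed
      finally show "4 * (1 - s n) * (2 * E / c (s n)) \<le> Q" .
      \<comment> \<open>For t \<le> 1 a larger exponent gives a smaller power, and
        \<open>2 * s n > 1\<close> on the tail. The bound no longer depends on
        \<open>n\<close>.\<close>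
      show "t powr (real DIM('a) + 2 * s n) \<le> t powr (real DIM('a) + 1)"
        using t n0(2)[OF n] by (intro powr_mono') auto
    qed (use \<open>0 \<le> Q\<close> in auto)
    also have "Q * t powr (real DIM('a) + 1) = Q * t * t ^ DIM('a)"
      using t by (simp add: powr_add powr_realpow)
    finally show ?thesis .
  qed
  show ?thesis
  proof (rule relatively_compact_in_closed)
    show "closed (L2_on \<Omega>)" using \<Omega> by (intro closed_L2_on) simp
    show "range u \<subseteq> L2_on \<Omega>" using assms(8) by auto
    fix e :: real assume "0 < e"
    have "\<exists>k. finite k \<and> k \<subseteq> A \<and> A \<subseteq> (\<Union>x\<in>k. ball x e)"
    proof (rule L2_on_totally_bounded[OF \<Omega>(3), where M = "sqrt E"])
      show "A \<subseteq> L2_on \<Omega>" using assms(8) by (auto simp: A_def)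
      show "norm v \<le> sqrt E" if "v \<in> A" for v
        using that norm_u by (auto simp: A_def intro: real_le_rsqrt)
      show "\<exists>t>0. \<forall>v\<in>A. osc (L2_fun v) t \<le> ennreal (\<eta> * t ^ DIM('a))" if "0 < \<eta>" for \<eta>
      proof -
        \<comment> \<open>Makes \<open>Q * t\<close> at most \<open>\<eta>\<close>. The denominator
          \<open>Q + 1\<close> stays positive when \<open>Q\<close> is 0.\<close>
        define t where "t = min 1 (\<eta> / (Q + 1))"
        have t: "0 < t" "t \<le> 1"
          using \<open>0 < \<eta>\<close> \<open>0 \<le> Q\<close> by (auto simp: t_def)
        have "Q * t \<le> (Q + 1) * (\<eta> / (Q + 1))"
          using \<open>0 \<le> Q\<close> \<open>0 < \<eta>\<close> t by (intro mult_mono) (auto simp: t_def)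
        then have "Q * t \<le> \<eta>"
          using \<open>0 \<le> Q\<close> by simp
        then have "osc (L2_fun (u n)) t \<le> ennreal (\<eta> * t ^ DIM('a))" if "n \<ge> n0" for n
          using t by (intro order_trans[OF osc_u[OF that t]] ennreal_leI mult_right_mono) auto
        with t(1) show ?thesis by (auto simp: A_def)
      qed
    qed fact
    then obtain k where k: "finite k" "A \<subseteq> (\<Union>x\<in>k. ball x e)" by blast
    \<comment> \<open>The lower bound for \<open>c\<close> holds only eventually. The finitely many
      earlier members are added as centres of their own balls.\<close>
    have "range u \<subseteq> u ` {..<n0} \<union> A"
      unfolding A_def image_Un[symmetric] by (intro image_mono) auto
    also have "\<dots> \<subseteq> (\<Union>x\<in>u ` {..<n0} \<union> k. ball x e)"
      using k(2) \<open>0 < e\<close> by fastforce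
    finally show "\<exists>k. finite k \<and> range u \<subseteq> (\<Union>x\<in>k. ball x e)"
      using k(1) by (intro exI[of _ "u ` {..<n0} \<union> k"]) auto
  qed
qed

end
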